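(* Let $\alpha$ be a tensor norm. Then $\alpha$ generates a dualizable Lipschitz cross-norm $\alpha^{L}$ such that for every pointed metric space $X$ and every Banach space $E$, $$\alpha^{L}\Big(\sum_{i=1}^{n}\delta_{(x_i,y_i)}\boxtimes e_i\Big)=\alpha\Big(\sum_{i=1}^{n}\delta_{(x_i,y_i)}\otimes e_i\Big)$$ for every $\sum_{i=1}^{n}\delta_{(x_i,y_i)}\boxtimes e_i\in X\boxtimes E$ (the right-hand side being computed in $\mathcal{F}(X)\otimes E$). In this case, the linear map $\Phi: X\boxtimes_{\alpha^{L}}E\to \mathcal{F}(X)\otimes_{\alpha}E$ given by $$\Phi\Big(\sum_{i=1}^{n}\delta_{(x_i,y_i)}\boxtimes e_i\Big)=\sum_{i=1}^{n}\delta_{(x_i,y_i)}\otimes e_i$$ is well-defined and is an isometry (onto its range).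
   Context: All spaces are real. A pointed metric space is a metric space $X$ with a distinguished point $0$. $X^{\#}$ is the Banach space of Lipschitz functions $f:X\to\mathbb{R}$ with $f(0)=0$, normed by the best Lipschitz constant $Lip(f)$. For a Banach space $E$, $Lip_0(X;E)$ is the Banach space of Lipschitz maps $T:X\to E$ with $T(0)=0$, with the Lipschitz norm $Lip(T)$. For $x,y\in X$, $\delta_{(x,y)}:X^{\#}\to\mathbb{R}$ is $\delta_{(x,y)}(f)=f(x)-f(y)$. $\mathcal{F}(X)$ is the completion of the linear span of the $\delta_{(x,y)}$ under the norm $\|m\|_{\mathcal{F}(X)}=\inf\{\sum_i|\lambda_i|d(x_i,y_i): m=\sum_i\lambda_i\delta_{(x_i,y_i)}\}$; one has $\mathcal{F}(X)^*=X^{\#}$. $X\boxtimes E$ (Lipschitz tensor product) is the linear span of the linear functionals $\delta_{(x,y)}\boxtimes e$ ($x,y\in X$, $e\in E$) on $Lip_0(X;E^* )$ defined by $(\delta_{(x,y)}\boxtimes e)(f)=\langle f(x)-f(y),e\rangle$. A norm $\beta$ on $X\boxtimes E$ is a Lipschitz cross-norm if $\beta(\delta_{(x,y)}\boxtimes e)=d(x,y)\|e\|$ for all $x,y\in X$, $e\in E$. It is dualizable if for all $f\in X^{\#}$, $e^*\in E^*$ and $\sum_{i=1}^n\delta_{(x_i,y_i)}\boxtimes e_i\in X\boxtimes E$, $$\Big|\sum_{i=1}^n (f(x_i)-f(y_i))\langle e^*,e_i\rangle\Big|\le Lip(f)\,\|e^*\|\,\beta\Big(\sum_{i=1}^n\delta_{(x_i,y_i)}\boxtimes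 e_i\Big).$$ $X\boxtimes_{\beta}E$ denotes $X\boxtimes E$ with the norm $\beta$. A tensor norm $\alpha$ assigns to every pair $(F,G)$ of Banach spaces a reasonable cross-norm on the algebraic tensor product $F\otimes G$ (so $\alpha(x\otimes g)=\|x\|\|g\|$ and $|(x^*\otimes g^* )(u)|\le\|x^*\|\|g^*\|\alpha(u)$), with the metric mapping property $\|S\otimes T\|\le\|S\|\|T\|$ for bounded linear operators $S,T$. $F\otimes_\alpha G$ denotes $F\otimes G$ with this norm. *)

theory Defs
  imports "HOL-Analysis.Analysis" "HOL-Library.Function_Algebras"
begin

section \<open>Pointwise vector space structure on real-valued functionals\<close>

instantiation "fun" :: (type, scaleR) scaleR
begin
definition scaleR_fun :: "real \<Rightarrow> ('a \<Rightarrow> 'b) \<Rightarrow> 'a \<Rightarrow> 'b"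
  where "scaleR_fun c f = (\<lambda>x. c *\<^sub>R f x)"
instance ..
end

lemma scaleR_fun_apply [simp]: "(c *\<^sub>R f) x = c *\<^sub>R f x"
  by (simp add: scaleR_fun_def)

instance "fun" :: (type, real_vector) real_vector
  by standard (simp_all add: fun_eq_iff algebra_simps)


section \<open>Normed spaces with varying carriers\<close>

text \<open>
  A tensor norm is an assignment on all pairs of Banach spaces, so Banach spaces have to be
  values and not types. A normed space is a linear subspace of an ambient real vector space
  \<open>'a\<close> (only the algebraic operations of \<open>'a\<close> are used), together with its norm;
  the values of the norm off the carrier are irrelevant.
\<close>

record 'a nspace =
  car :: "'a set"
  nrm :: "'a \<Rightarrow> real"

definition norm_on :: "'a::real_vector set \<Rightarrow> ('a \<Rightarrow> real) \<Rightarrow> bool" where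
  "norm_on S N \<longleftrightarrow>
     (\<forall>x\<in>S. 0 \<le> N x) \<and> (\<forall>x\<in>S. N x = 0 \<longleftrightarrow> x = 0) \<and>
     (\<forall>x\<in>S. \<forall>c. N (c *\<^sub>R x) = \<bar>c\<bar> * N x) \<and>
     (\<forall>x\<in>S. \<forall>y\<in>S. N (x + y) \<le> N x + N y)"

definition normed_space :: "'a::real_vector nspace \<Rightarrow> bool" where
  "normed_space V \<longleftrightarrow> subspace (car V) \<and> norm_on (car V) (nrm V)"

text \<open>
  Cut off to \<open>0\<close> outside the carrier because the library's \<^locale>\<open>Metric_space\<close> demands
  nonnegativity and symmetry on the whole type.
\<close>

definition ndist :: "'a::real_vector nspace \<Rightarrow> 'a \<Rightarrow> 'a \<Rightarrow> real" where
  "ndist V x y = (if x \<in> car V \<and> y \<in> car V then nrm V (x - y) else 0)"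

definition norm_metric :: "'a::real_vector nspace \<Rightarrow> 'a metric" where
  "norm_metric V = metric (car V, ndist V)"

definition banach_space :: "'a::real_vector nspace \<Rightarrow> bool" where
  "banach_space V \<longleftrightarrow> normed_space V \<and> mcomplete_of (norm_metric V)"

definition real_line :: "real nspace" where
  "real_line = \<lparr>car = UNIV, nrm = abs\<rparr>"

definition linear_op :: "'a::real_vector nspace \<Rightarrow> 'b::real_vector nspace \<Rightarrow> ('a \<Rightarrow> 'b) \<Rightarrow> bool" where
  "linear_op V W T \<longleftrightarrow>
     T \<in> car V \<rightarrow> car W \<and>
     (\<forall>x\<in>car V. \<forall>y\<in>car V. T (x + y) = T x + T y) \<and>
     (\<forall>x\<in>car V. \<forall>c. T (c *\<^sub>R x) = c *\<^sub>R T x)"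

definition bounded_op :: "'a::real_vector nspace \<Rightarrow> 'b::real_vector nspace \<Rightarrow> ('a \<Rightarrow> 'b) \<Rightarrow> bool" where
  "bounded_op V W T \<longleftrightarrow>
     linear_op V W T \<and> (\<exists>K. \<forall>x\<in>car V. nrm W (T x) \<le> K * nrm V x)"

definition op_norm :: "'a::real_vector nspace \<Rightarrow> 'b::real_vector nspace \<Rightarrow> ('a \<Rightarrow> 'b) \<Rightarrow> real" where
  "op_norm V W T = Inf {K. 0 \<le> K \<and> (\<forall>x\<in>car V. nrm W (T x) \<le> K * nrm V x)}"

definition linear_isometry :: "'a::real_vector nspace \<Rightarrow> 'b::real_vector nspace \<Rightarrow> ('a \<Rightarrow> 'b) \<Rightarrow> bool" where
  "linear_isometry V W T \<longleftrightarrow> linear_op V W T \<and> (\<forall>x\<in>car V. nrm W (T x) = nrm V x)"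

text \<open>
  Here and below, maps defined on a carrier are represented by their extension by zero, so that
  each such map has exactly one representative.
\<close>

definition dual :: "'a::real_vector nspace \<Rightarrow> ('a \<Rightarrow> real) nspace" where
  "dual V = \<lparr>car = {\<phi>. bounded_op V real_line \<phi> \<and> (\<forall>x. x \<notin> car V \<longrightarrow> \<phi> x = 0)},
             nrm = op_norm V real_line\<rparr>"


section \<open>Algebraic tensor products and tensor norms\<close>

text \<open>
  The algebraic tensor product \<open>F \<otimes> G\<close> is realized as the span of the elementary tensors
  \<open>x \<otimes> y\<close>, where \<open>x \<otimes> y\<close> is the functional \<open>B \<mapsto> B x y\<close> on the bilinear forms on \<open>F \<times> G\<close>.
\<close>

definition bilinear_forms ::
    "'a::real_vector nspace \<Rightarrow> 'b::real_vector nspace \<Rightarrow> ('a \<Rightarrow> 'b \<Rightarrow> real) set" where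
  "bilinear_forms F G = {B.
     (\<forall>x\<in>car F. linear_op G real_line (B x)) \<and>
     (\<forall>y\<in>car G. linear_op F real_line (\<lambda>x. B x y)) \<and>
     (\<forall>x y. x \<notin> car F \<or> y \<notin> car G \<longrightarrow> B x y = 0)}"

definition tensor :: "'a::real_vector nspace \<Rightarrow> 'b::real_vector nspace \<Rightarrow>
    'a \<Rightarrow> 'b \<Rightarrow> ('a \<Rightarrow> 'b \<Rightarrow> real) \<Rightarrow> real" where
  "tensor F G x y = (\<lambda>B. if B \<in> bilinear_forms F G then B x y else 0)"

definition tensor_product :: "'a::real_vector nspace \<Rightarrow> 'b::real_vector nspace \<Rightarrow>
    (('a \<Rightarrow> 'b \<Rightarrow> real) \<Rightarrow> real) set" where
  "tensor_product F G = span {tensor F G x y | x y. x \<in> car F \<and> y \<in> car G}"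

text \<open>
  The map \<open>S \<otimes> T\<close>, which is determined by \<open>x \<otimes> y \<mapsto> S x \<otimes> T y\<close>, is
  precomposition with \<open>B \<mapsto> B (S _) (T _)\<close>, and \<open>x\<^sup>* \<otimes> y\<^sup>*\<close> is evaluation at the
  bilinear form \<open>(x, y) \<mapsto> x\<^sup>*(x) y\<^sup>*(y)\<close>.
\<close>

definition tensor_map :: "'a::real_vector nspace \<Rightarrow> 'b::real_vector nspace \<Rightarrow>
    'c::real_vector nspace \<Rightarrow> 'd::real_vector nspace \<Rightarrow> ('a \<Rightarrow> 'c) \<Rightarrow> ('b \<Rightarrow> 'd) \<Rightarrow>
    (('a \<Rightarrow> 'b \<Rightarrow> real) \<Rightarrow> real) \<Rightarrow> ('c \<Rightarrow> 'd \<Rightarrow> real) \<Rightarrow> real" where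
  "tensor_map F G F' G' S T u =
     (\<lambda>B. if B \<in> bilinear_forms F' G'
          then u (\<lambda>x y. if x \<in> car F \<and> y \<in> car G then B (S x) (T y) else 0) else 0)"

definition tensor_functional :: "('a \<Rightarrow> real) \<Rightarrow> ('b \<Rightarrow> real) \<Rightarrow>
    (('a \<Rightarrow> 'b \<Rightarrow> real) \<Rightarrow> real) \<Rightarrow> real" where
  "tensor_functional \<phi> \<psi> u = u (\<lambda>x y. \<phi> x * \<psi> y)"

definition reasonable_cross_norm :: "'a::real_vector nspace \<Rightarrow> 'b::real_vector nspace \<Rightarrow>
    ((('a \<Rightarrow> 'b \<Rightarrow> real) \<Rightarrow> real) \<Rightarrow> real) \<Rightarrow> bool" where
  "reasonable_cross_norm F G \<nu> \<longleftrightarrow>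
     norm_on (tensor_product F G) \<nu> \<and>
     (\<forall>x\<in>car F. \<forall>y\<in>car G. \<nu> (tensor F G x y) = nrm F x * nrm G y) \<and>
     (\<forall>\<phi>\<in>car (dual F). \<forall>\<psi>\<in>car (dual G). \<forall>u\<in>tensor_product F G.
        \<bar>tensor_functional \<phi> \<psi> u\<bar> \<le> nrm (dual F) \<phi> * nrm (dual G) \<psi> * \<nu> u)"

type_synonym ('a, 'b) tensor_norm_assignment =
  "'a nspace \<Rightarrow> 'b nspace \<Rightarrow> (('a \<Rightarrow> 'b \<Rightarrow> real) \<Rightarrow> real) \<Rightarrow> real"

definition tensor_space :: "('a::real_vector, 'b::real_vector) tensor_norm_assignment \<Rightarrow>
    'a nspace \<Rightarrow> 'b nspace \<Rightarrow> (('a \<Rightarrow> 'b \<Rightarrow> real) \<Rightarrow> real) nspace" where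
  "tensor_space \<alpha> F G = \<lparr>car = tensor_product F G, nrm = \<alpha> F G\<rparr>"

text \<open>
  There is no type of all Banach spaces: \<open>\<alpha>\<close> ranges over the Banach spaces \<open>F\<close> inside the
  ambient space \<open>'a\<close> and \<open>G\<close> inside \<open>'b\<close>. Every tensor norm on the class of all Banach
  spaces restricts to such an assignment.
\<close>

definition tensor_norm :: "('a::real_vector, 'b::real_vector) tensor_norm_assignment \<Rightarrow> bool" where
  "tensor_norm \<alpha> \<longleftrightarrow>
     (\<forall>F G. banach_space F \<and> banach_space G \<longrightarrow> reasonable_cross_norm F G (\<alpha> F G)) \<and>
     (\<forall>F G F' G' S T.
        banach_space F \<and> banach_space G \<and> banach_space F' \<and> banach_space G' \<and>
        bounded_op F F' S \<and> bounded_op G G' T \<longrightarrow>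
        bounded_op (tensor_space \<alpha> F G) (tensor_space \<alpha> F' G') (tensor_map F G F' G' S T) \<and>
        op_norm (tensor_space \<alpha> F G) (tensor_space \<alpha> F' G') (tensor_map F G F' G' S T)
          \<le> op_norm F F' S * op_norm G G' T)"


section \<open>Lipschitz functions and the Lipschitz-free space\<close>

text \<open>
  A pointed metric space is a metric space \<open>X\<close>, given as a value of the library's type of
  metric spaces, with a base point \<open>z \<in> mspace X\<close>.
\<close>

definition lip_const :: "'x metric \<Rightarrow> 'a::real_vector nspace \<Rightarrow> ('x \<Rightarrow> 'a) \<Rightarrow> real" where
  "lip_const X V T =
     Inf {C. 0 \<le> C \<and> (\<forall>x\<in>mspace X. \<forall>y\<in>mspace X. nrm V (T x - T y) \<le> C * mdist X x y)}"

definition Lip0 :: "'x metric \<Rightarrow> 'x \<Rightarrow> 'a::real_vector nspace \<Rightarrow> ('x \<Rightarrow> 'a) nspace" where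
  "Lip0 X z V =
     \<lparr>car = {T. Lipschitz_continuous_map X (norm_metric V) T \<and> T z = 0 \<and>
                (\<forall>x. x \<notin> mspace X \<longrightarrow> T x = 0)},
      nrm = lip_const X V\<rparr>"

definition lip_dual :: "'x metric \<Rightarrow> 'x \<Rightarrow> ('x \<Rightarrow> real) nspace" where
  "lip_dual X z = Lip0 X z real_line"

definition delta :: "'x metric \<Rightarrow> 'x \<Rightarrow> 'x \<Rightarrow> 'x \<Rightarrow> ('x \<Rightarrow> real) \<Rightarrow> real" where
  "delta X z x y = (\<lambda>f. if f \<in> car (lip_dual X z) then f x - f y else 0)"

definition molecules :: "'x metric \<Rightarrow> 'x \<Rightarrow> (('x \<Rightarrow> real) \<Rightarrow> real) nspace" where
  "molecules X z =
     \<lparr>car = span {delta X z x y | x y. x \<in> mspace X \<and> y \<in> mspace X},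
      nrm = (\<lambda>m. Inf {(\<Sum>i<n. \<bar>c i\<bar> * mdist X (x i) (y i)) | (n::nat) c x y.
                (\<forall>i<n. x i \<in> mspace X \<and> y i \<in> mspace X) \<and>
                m = (\<Sum>i<n. c i *\<^sub>R delta X z (x i) (y i))})\<rparr>"

text \<open>
  The completion of \<^const>\<open>molecules\<close>, with the class of a Cauchy sequence of molecules represented
  by its pointwise limit on \<open>X\<^sup>#\<close>. Lemma \<open>lip_free_completion\<close> at the end of this theory
  shows that the result is a Banach space containing the molecules isometrically and densely.
\<close>

definition cauchy_limit :: "('i \<Rightarrow> real) nspace \<Rightarrow> (nat \<Rightarrow> 'i \<Rightarrow> real) \<Rightarrow> ('i \<Rightarrow> real) \<Rightarrow> bool" where
  "cauchy_limit V s m \<longleftrightarrow>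
     Metric_space.MCauchy (car V) (ndist V) s \<and> (\<forall>f. (\<lambda>n. s n f) \<longlonglongrightarrow> m f)"

definition lip_free :: "'x metric \<Rightarrow> 'x \<Rightarrow> (('x \<Rightarrow> real) \<Rightarrow> real) nspace" where
  "lip_free X z =
     \<lparr>car = {m. \<exists>s. cauchy_limit (molecules X z) s m},
      nrm = (\<lambda>m. THE r. \<exists>s. cauchy_limit (molecules X z) s m \<and>
                            (\<lambda>n. nrm (molecules X z) (s n)) \<longlonglongrightarrow> r)\<rparr>"


section \<open>Lipschitz tensor products\<close>

definition lip_tensor :: "'x metric \<Rightarrow> 'x \<Rightarrow> 'e::real_vector nspace \<Rightarrow>
    'x \<Rightarrow> 'x \<Rightarrow> 'e \<Rightarrow> ('x \<Rightarrow> 'e \<Rightarrow> real) \<Rightarrow> real" where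
  "lip_tensor X z E x y e = (\<lambda>f. if f \<in> car (Lip0 X z (dual E)) then (f x - f y) e else 0)"

definition lip_tensor_product :: "'x metric \<Rightarrow> 'x \<Rightarrow> 'e::real_vector nspace \<Rightarrow>
    (('x \<Rightarrow> 'e \<Rightarrow> real) \<Rightarrow> real) set" where
  "lip_tensor_product X z E =
     span {lip_tensor X z E x y e | x y e. x \<in> mspace X \<and> y \<in> mspace X \<and> e \<in> car E}"

definition lip_tensor_space :: "((('x \<Rightarrow> 'e \<Rightarrow> real) \<Rightarrow> real) \<Rightarrow> real) \<Rightarrow>
    'x metric \<Rightarrow> 'x \<Rightarrow> 'e::real_vector nspace \<Rightarrow> (('x \<Rightarrow> 'e \<Rightarrow> real) \<Rightarrow> real) nspace" where
  "lip_tensor_space \<beta> X z E = \<lparr>car = lip_tensor_product X z E, nrm = \<beta>\<rparr>"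

definition lip_cross_norm :: "'x metric \<Rightarrow> 'x \<Rightarrow> 'e::real_vector nspace \<Rightarrow>
    ((('x \<Rightarrow> 'e \<Rightarrow> real) \<Rightarrow> real) \<Rightarrow> real) \<Rightarrow> bool" where
  "lip_cross_norm X z E \<beta> \<longleftrightarrow>
     norm_on (lip_tensor_product X z E) \<beta> \<and>
     (\<forall>x\<in>mspace X. \<forall>y\<in>mspace X. \<forall>e\<in>car E. \<beta> (lip_tensor X z E x y e) = mdist X x y * nrm E e)"

definition dualizable :: "'x metric \<Rightarrow> 'x \<Rightarrow> 'e::real_vector nspace \<Rightarrow>
    ((('x \<Rightarrow> 'e \<Rightarrow> real) \<Rightarrow> real) \<Rightarrow> real) \<Rightarrow> bool" where
  "dualizable X z E \<beta> \<longleftrightarrow>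
     (\<forall>f\<in>car (lip_dual X z). \<forall>\<phi>\<in>car (dual E). \<forall>(n::nat) x y e.
        (\<forall>i<n. x i \<in> mspace X \<and> y i \<in> mspace X \<and> e i \<in> car E) \<longrightarrow>
        \<bar>\<Sum>i<n. (f (x i) - f (y i)) * \<phi> (e i)\<bar>
          \<le> nrm (lip_dual X z) f * nrm (dual E) \<phi> * \<beta> (\<Sum>i<n. lip_tensor X z E (x i) (y i) (e i)))"

section \<open>\<open>lip_free\<close> is the completion of the molecules\<close>

definition is_completion :: "'a::real_vector nspace \<Rightarrow> 'a nspace \<Rightarrow> bool" where
  "is_completion V C \<longleftrightarrow>
     banach_space C \<and> car V \<subseteq> car C \<and> (\<forall>v\<in>car V. nrm C v = nrm V v) \<and>
     (\<forall>c\<in>car C. \<forall>\<epsilon>>0. \<exists>v\<in>car V. nrm C (c - v) < \<epsilon>)"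

subsection \<open>Hahn-Banach\<close>

definition sublinear :: "('a::real_vector \<Rightarrow> real) \<Rightarrow> bool" where
  "sublinear q \<longleftrightarrow> (\<forall>x y. q (x + y) \<le> q x + q y) \<and> (\<forall>c x. 0 \<le> c \<longrightarrow> q (c *\<^sub>R x) = c * q x)"

lemma sublinear_D:
  assumes "sublinear q"
  shows "q (x + y) \<le> q x + q y" "0 \<le> c \<Longrightarrow> q (c *\<^sub>R x) = c * q x" "q 0 = 0" "- q (- x) \<le> q x"
proof -
  show "q (x + y) \<le> q x + q y" "0 \<le> c \<Longrightarrow> q (c *\<^sub>R x) = c * q x" for x y c
    using assms by (auto simp: sublinear_def)
  show 0: "q 0 = 0"
    using assms unfolding sublinear_def by (metis order_refl mult_zero_left scaleR_zero_left)
  show "- q (- x) \<le> q x"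
    using assms 0 unfolding sublinear_def by (smt (verit) add.right_inverse)
qed

lemma sublinear_lower:
  fixes q :: "'a::real_vector \<Rightarrow> real"
  assumes q: "sublinear q"
  obtains q' where "sublinear q'" "\<And>x. q' x \<le> q x" "\<And>x. q' x + q v \<le> q (x + v)"
proof -
  define S where "S x = {q (x + t *\<^sub>R v) - t * q v | t. 0 \<le> t}" for x
  define q' where "q' x = Inf (S x)" for x
  note q1 = sublinear_D(1)[OF q] and q2 = sublinear_D(2)[OF q] and q0 = sublinear_D(3)[OF q]
  have lb: "- q (- x) \<le> r" if r: "r \<in> S x" for x r
  proof -
    obtain t where t: "0 \<le> t" "r = q (x + t *\<^sub>R v) - t * q v" using r by (auto simp: S_def)
    have "t * q v = q (t *\<^sub>R v)" using q2 t by simp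
    also have "\<dots> \<le> q (x + t *\<^sub>R v) + q (- x)"
      using q1[of "x + t *\<^sub>R v" "- x"] by simp
    finally show ?thesis using t by simp
  qed
  have bdd: "bdd_below (S x)" for x using lb by (meson bdd_belowI)
  have up: "q' x \<le> q (x + t *\<^sub>R v) - t * q v" if "0 \<le> t" for x t
    unfolding q'_def by (rule cInf_lower[OF _ bdd]) (use that in \<open>auto simp: S_def\<close>)
  have ne: "S x \<noteq> {}" for x by (auto simp: S_def)
  have gr: "a \<le> q' x" if "\<And>t. 0 \<le> t \<Longrightarrow> a \<le> q (x + t *\<^sub>R v) - t * q v" for a x
    unfolding q'_def by (rule cInf_greatest[OF ne]) (use that in \<open>auto simp: S_def\<close>)
  have add: "q' (x + y) \<le> q' x + q' y" for x y
  proof -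
    have "q' (x + y) - (q (y + s *\<^sub>R v) - s * q v) \<le> q' x" if s: "0 \<le> s" for s
    proof (rule gr)
      fix t :: real assume t: "0 \<le> t"
      have "q' (x + y) \<le> q (x + y + (t + s) *\<^sub>R v) - (t + s) * q v" using up s t by simp
      also have "x + y + (t + s) *\<^sub>R v = (x + t *\<^sub>R v) + (y + s *\<^sub>R v)"
        by (simp add: algebra_simps)
      also have "q \<dots> \<le> q (x + t *\<^sub>R v) + q (y + s *\<^sub>R v)" by (rule q1)
      finally show "q' (x + y) - (q (y + s *\<^sub>R v) - s * q v) \<le> q (x + t *\<^sub>R v) - t * q v"
        by (simp add: algebra_simps)
    qed
    then have "q' (x + y) - q' x \<le> q' y" by (intro gr) (smt (verit))
    then show ?thesis by simp
  qed
  have q'0: "q' 0 = 0"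
  proof (rule antisym)
    show "q' 0 \<le> 0" using up[of 0 0] q0 by simp
    show "0 \<le> q' 0" by (rule gr) (simp add: q2)
  qed
  have sc_le: "c * q' x \<le> q' (c *\<^sub>R x)" if c: "0 < c" for c x
  proof (rule gr)
    fix t :: real assume t: "0 \<le> t"
    have "q' x \<le> q (x + (t / c) *\<^sub>R v) - (t / c) * q v" using up[of "t / c" x] t c by simp
    then have "c * q' x \<le> c * (q (x + (t / c) *\<^sub>R v) - (t / c) * q v)" using c by simp
    also have "\<dots> = q (c *\<^sub>R (x + (t / c) *\<^sub>R v)) - t * q v"
      using c q2[of c "x + (t / c) *\<^sub>R v"] by (simp add: algebra_simps)
    also have "c *\<^sub>R (x + (t / c) *\<^sub>R v) = c *\<^sub>R x + t *\<^sub>R v"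
      using c by (simp add: algebra_simps)
    finally show "c * q' x \<le> q (c *\<^sub>R x + t *\<^sub>R v) - t * q v" .
  qed
  have sc: "q' (c *\<^sub>R x) = c * q' x" if c: "0 \<le> c" for c x
  proof (cases "c = 0")
    case False
    then have c0: "0 < c" using c by simp
    have "(1/c) * q' (c *\<^sub>R x) \<le> q' ((1/c) *\<^sub>R (c *\<^sub>R x))" using sc_le[of "1/c" "c *\<^sub>R x"] c0 by simp
    then have "q' (c *\<^sub>R x) \<le> c * q' x" using c0 by (simp add: field_simps)
    then show ?thesis using sc_le[OF c0] by (simp add: antisym)
  qed (simp add: q'0)
  show ?thesis
  proof
    show "sublinear q'" using add sc by (auto simp: sublinear_def)
    show "q' x \<le> q x" for x using up[of 0 x] by simp
    show "q' x + q v \<le> q (x + v)" for x using up[of 1 x] by simp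
  qed
qed

lemma hahn_banach_sublinear:
  fixes p :: "'a::real_vector \<Rightarrow> real"
  assumes p: "sublinear p"
  obtains \<phi> where "linear \<phi>" "\<And>x. \<phi> x \<le> p x" "\<phi> v = p v"
proof -
  obtain p0 where p0: "sublinear p0" "\<And>x. p0 x \<le> p x" "\<And>x. p0 x + p v \<le> p (x + v)"
    using sublinear_lower[OF p] by metis
  define A where "A = {q. sublinear q \<and> (\<forall>x. q x \<le> p0 x)}"
  define P where "P q q' \<longleftrightarrow> (\<forall>x. q' x \<le> q x)" for q q' :: "'a \<Rightarrow> real"
  have po: "partial_order_on A (relation_of P A)"
    by (rule partial_order_on_relation_ofI) (auto simp: P_def fun_eq_iff intro: order_trans antisym)
  have ch: "\<exists>u\<in>A. \<forall>a\<in>C. P a u" if C: "C \<in> Chains (relation_of P A)" for C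
  proof (cases "C = {}")
    case True
    then show ?thesis using p0(1) by (auto simp: A_def)
  next
    case False
    have CA: "C \<subseteq> A" and tot: "\<And>a b. a \<in> C \<Longrightarrow> b \<in> C \<Longrightarrow> P a b \<or> P b a"
      using C by (auto simp: Chains_def relation_of_def)
    define u where "u x = (INF q\<in>C. q x)" for x
    have lb: "- p0 (- x) \<le> q x" if "q \<in> C" for q x
    proof -
      have "sublinear q" "q (- x) \<le> p0 (- x)" using that CA by (auto simp: A_def)
      then show ?thesis using sublinear_D(4)[of q x] by simp
    qed
    have bdd: "bdd_below ((\<lambda>q. q x) ` C)" for x using lb by (intro bdd_belowI2)
    have ul: "u x \<le> q x" if "q \<in> C" for q x
      unfolding u_def by (rule cINF_lower[OF bdd that])
    have ug: "a \<le> u x" if "\<And>q. q \<in> C \<Longrightarrow> a \<le> q x" for a x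
      unfolding u_def by (rule cINF_greatest[OF False that])
    have "sublinear u"
      unfolding sublinear_def
    proof (intro conjI allI impI)
      fix x y
      have "u (x + y) - q x \<le> u y" if q: "q \<in> C" for q
      proof (rule ug)
        fix r assume r: "r \<in> C"
        obtain s where s: "s \<in> C" "s x \<le> q x" "s y \<le> r y"
          using tot[OF q r] q r unfolding P_def by (meson order_refl)
        have "s (x + y) \<le> s x + s y" using s(1) CA sublinear_D(1)[of s] by (auto simp: A_def)
        then show "u (x + y) - q x \<le> r y" using s ul[OF s(1), of "x + y"] by simp
      qed
      then have "u (x + y) - u y \<le> u x" by (intro ug) (smt (verit))
      then show "u (x + y) \<le> u x + u y" by simp
    next
      fix c :: real and x assume c: "0 \<le> c"
      have sc: "q (c *\<^sub>R y) = c * q y" if "q \<in> C" "0 \<le> c" for q c y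
        using that CA sublinear_D(2)[of q c y] by (auto simp: A_def)
      have le: "c * u y \<le> u (c *\<^sub>R y)" if "0 \<le> c" for c y
      proof (rule ug)
      fix q assume q: "q \<in> C"
      show "c * u y \<le> q (c *\<^sub>R y)"
        using mult_left_mono[OF ul[OF q, of y] that] sc[OF q that, of y] by simp
    qed
      show "u (c *\<^sub>R x) = c * u x"
      proof (cases "c = 0")
        case True
        have "u 0 = 0"
        proof (rule antisym)
          obtain q where "q \<in> C" using False by blast
          then show "u 0 \<le> 0" using ul[of q 0] sc[of q 0 0] by simp
          show "0 \<le> u 0" by (rule ug) (use sc[of _ 0 0] in fastforce)
        qed
        then show ?thesis using True by simp
      next
        case False
        have "(1/c) * u (c *\<^sub>R x) \<le> u ((1/c) *\<^sub>R (c *\<^sub>R x))" using le[of "1/c" "c *\<^sub>R x"] c False by simp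
        then have "u (c *\<^sub>R x) \<le> c * u x" using c False by (simp add: field_simps)
        then show ?thesis using le[OF c] by (simp add: antisym)
      qed
    qed
    moreover have "u x \<le> p0 x" for x
    proof -
      obtain q where "q \<in> C" using False by blast
      then show ?thesis using ul[of q x] CA by (auto simp: A_def intro: order_trans)
    qed
    ultimately have "u \<in> A" by (auto simp: A_def)
    then show ?thesis using ul by (auto simp: P_def)
  qed
  obtain m where m: "m \<in> A" "\<And>a. a \<in> A \<Longrightarrow> P m a \<Longrightarrow> a = m"
    using predicate_Zorn[OF po ch] by blast
  have sm: "sublinear m" and mp: "\<And>x. m x \<le> p0 x" using m(1) by (auto simp: A_def)
  have sup: "m x + m w \<le> m (x + w)" for x w
  proof -
    obtain q where q: "sublinear q" "\<And>x. q x \<le> m x" "\<And>x. q x + m w \<le> m (x + w)"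
      using sublinear_lower[OF sm] by metis
    have "q \<in> A" using q mp by (auto simp: A_def intro: order_trans)
    then have "q = m" using m(2) q(2) by (auto simp: P_def)
    then show ?thesis using q(3) by metis
  qed
  have add: "m (x + y) = m x + m y" for x y
    using sup sublinear_D(1)[OF sm] by (simp add: antisym)
  have neg: "m (- x) = - m x" for x
    using add[of x "- x"] sublinear_D(3)[OF sm] by simp
  have sc: "m (c *\<^sub>R x) = c * m x" for c x
  proof (cases "0 \<le> c")
    case False
    then have "m ((- c) *\<^sub>R x) = - c * m x" by (intro sublinear_D(2)[OF sm]) simp
    then show ?thesis using neg[of "c *\<^sub>R x"] by simp
  qed (use sublinear_D(2)[OF sm] in simp)
  show ?thesis
  proof
    show "linear m" by (rule linearI) (simp_all add: add sc)
    show le: "m x \<le> p x" for x using mp p0(2) order_trans by blast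
    have "m (- v) \<le> - p v" using mp[of "- v"] p0(3)[of "- v"] sublinear_D(3)[OF p] by simp
    then show "m v = p v" using neg le[of v] by simp
  qed
qed

lemma hahn_banach_norming:
  fixes V :: "'a::real_vector nspace"
  assumes V: "normed_space V" and v: "v \<in> car V"
  obtains \<phi> where "linear \<phi>" "\<And>x. x \<in> car V \<Longrightarrow> \<bar>\<phi> x\<bar> \<le> nrm V x" "\<phi> v = nrm V v"
proof -
  have sub: "subspace (car V)" and no: "norm_on (car V) (nrm V)"
    using V by (auto simp: normed_space_def)
  obtain P where P: "range P \<subseteq> car V" "linear P" "\<And>x. x \<in> car V \<Longrightarrow> P x = x"
    using linear_exists_left_inverse_on[OF linear_id sub] by (auto simp: id_def)
  have Pc: "P x \<in> car V" for x using P(1) by blast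
  have "sublinear (\<lambda>x. nrm V (P x))"
    using no Pc by (auto simp: sublinear_def norm_on_def linear_add[OF P(2)] linear_scale[OF P(2)])
  then obtain \<phi> where phi: "linear \<phi>" "\<And>x. \<phi> x \<le> nrm V (P x)" "\<phi> v = nrm V (P v)"
    using hahn_banach_sublinear[where v = v] by blast
  show ?thesis
  proof
    show "linear \<phi>" by fact
    show "\<phi> v = nrm V v" using phi(3) P(3) v by simp
    fix x assume x: "x \<in> car V"
    have "- x = (-1) *\<^sub>R x" by simp
    then have "nrm V (- x) = nrm V x" using no x unfolding norm_on_def by (metis abs_minus_cancel abs_one mult_1)
    moreover have "- x \<in> car V" using x sub by (simp add: subspace_neg)
    ultimately have "\<phi> (- x) \<le> nrm V x" "\<phi> x \<le> nrm V x"
      using phi(2)[of x] phi(2)[of "- x"] P(3) x by auto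
    then show "\<bar>\<phi> x\<bar> \<le> nrm V x" using linear_neg[OF phi(1)] by simp
  qed
qed

subsection \<open>The pointwise completion\<close>

lemma normed_space_D:
  assumes "normed_space V"
  shows "subspace (car V)"
    and "x \<in> car V \<Longrightarrow> 0 \<le> nrm V x" "x \<in> car V \<Longrightarrow> nrm V x = 0 \<longleftrightarrow> x = 0"
    and "x \<in> car V \<Longrightarrow> nrm V (c *\<^sub>R x) = \<bar>c\<bar> * nrm V x"
    and "x \<in> car V \<Longrightarrow> y \<in> car V \<Longrightarrow> nrm V (x + y) \<le> nrm V x + nrm V y"
    and "x \<in> car V \<Longrightarrow> y \<in> car V \<Longrightarrow> nrm V (x - y) \<le> nrm V x + nrm V y"
    and "x \<in> car V \<Longrightarrow> y \<in> car V \<Longrightarrow> nrm V (x - y) = nrm V (y - x)"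
    and "x \<in> car V \<Longrightarrow> y \<in> car V \<Longrightarrow> \<bar>nrm V x - nrm V y\<bar> \<le> nrm V (x - y)"
proof -
  have S: "subspace (car V)" and no: "norm_on (car V) (nrm V)"
    using assms by (simp_all add: normed_space_def)
  have n1: "\<forall>x\<in>car V. 0 \<le> nrm V x" and n2: "\<forall>x\<in>car V. nrm V x = 0 \<longleftrightarrow> x = 0"
    and n3: "\<forall>x\<in>car V. \<forall>c. nrm V (c *\<^sub>R x) = \<bar>c\<bar> * nrm V x"
    and n4: "\<forall>x\<in>car V. \<forall>y\<in>car V. nrm V (x + y) \<le> nrm V x + nrm V y"
    using no unfolding norm_on_def by - (elim conjE, assumption)+
  note a = bspec[OF bspec[OF n4]] and c = spec[OF bspec[OF n3]]
  have n: "nrm V (- x) = nrm V x" if "x \<in> car V" for x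
    using c[OF that, of "-1"] by simp
  have m: "nrm V (x - y) = nrm V (y - x)" if "x \<in> car V" "y \<in> car V" for x y
    using n[of "x - y"] that S by (simp add: subspace_diff)
  have d: "nrm V x \<le> nrm V (x - y) + nrm V y" if "x \<in> car V" "y \<in> car V" for x y
    using a[of "x - y" y] that S by (simp add: subspace_diff)
  show "subspace (car V)" by (rule S)
  show "x \<in> car V \<Longrightarrow> 0 \<le> nrm V x" "x \<in> car V \<Longrightarrow> nrm V x = 0 \<longleftrightarrow> x = 0"
    by (rule bspec[OF n1] bspec[OF n2], assumption)+
  show "x \<in> car V \<Longrightarrow> nrm V (c *\<^sub>R x) = \<bar>c\<bar> * nrm V x" by (rule c)
  assume x: "x \<in> car V" and y: "y \<in> car V"
  show "nrm V (x + y) \<le> nrm V x + nrm V y" using x y by (rule a)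
  show "nrm V (x - y) \<le> nrm V x + nrm V y"
    using a[of x "- y"] n x y S by (simp add: subspace_neg)
  show "nrm V (x - y) = nrm V (y - x)" using x y by (rule m)
  show "\<bar>nrm V x - nrm V y\<bar> \<le> nrm V (x - y)"
    using d[OF x y] d[OF y x] m[OF x y] by linarith
qed

lemma Metric_space_ndist:
  assumes "normed_space V"
  shows "Metric_space (car V) (ndist V)"
proof -
  note N = normed_space_D[OF assms]
  have tri: "nrm V (x - z) \<le> nrm V (x - y) + nrm V (y - z)"
    if "x \<in> car V" "y \<in> car V" "z \<in> car V" for x y z
    using N(5)[of "x - y" "y - z"] that N(1) by (simp add: subspace_diff)
  show ?thesis
    by unfold_locales (auto simp: ndist_def N subspace_diff tri)
qed

lemma MCauchy_ndist:
  assumes "normed_space V"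
  shows "Metric_space.MCauchy (car V) (ndist V) s \<longleftrightarrow>
    (\<forall>n. s n \<in> car V) \<and> (\<forall>\<epsilon>>0. \<exists>N. \<forall>n\<ge>N. \<forall>k\<ge>N. nrm V (s n - s k) < \<epsilon>)"
proof (cases "\<forall>n. s n \<in> car V")
  case True
  then have "ndist V (s n) (s k) = nrm V (s n - s k)" for n k by (simp add: ndist_def)
  then show ?thesis
    using True unfolding Metric_space.MCauchy_def[OF Metric_space_ndist[OF assms]]
    by (simp add: image_subset_iff imp_conjL)
next
  case False
  then show ?thesis
    unfolding Metric_space.MCauchy_def[OF Metric_space_ndist[OF assms]] by blast
qed

lemma banach_spaceI:
  assumes V: "normed_space V"
    and lim: "\<And>s. (\<And>n. s n \<in> car V) \<Longrightarrow>
      (\<And>\<epsilon>. \<epsilon> > 0 \<Longrightarrow> \<exists>N. \<forall>n\<ge>N. \<forall>k\<ge>N. nrm V (s n - s k) < \<epsilon>) \<Longrightarrow>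
      \<exists>l\<in>car V. (\<lambda>n. nrm V (s n - l)) \<longlonglongrightarrow> 0"
  shows "banach_space V"
proof -
  interpret M: Metric_space "car V" "ndist V" by (rule Metric_space_ndist[OF V])
  have "M.mcomplete"
    unfolding M.mcomplete_def
  proof (intro allI impI)
    fix s assume "M.MCauchy s"
    then have s: "\<And>n. s n \<in> car V" "\<And>\<epsilon>. \<epsilon> > 0 \<Longrightarrow> \<exists>N. \<forall>n\<ge>N. \<forall>k\<ge>N. nrm V (s n - s k) < \<epsilon>"
      by (auto simp: MCauchy_ndist[OF V])
    obtain l where l: "l \<in> car V" "(\<lambda>n. nrm V (s n - l)) \<longlonglongrightarrow> 0" using lim[OF s] by blast
    have "limitin M.mtopology s l sequentially"
      unfolding M.limit_metric_sequentially
    proof (intro conjI allI impI)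
      fix \<epsilon> :: real assume "\<epsilon> > 0"
      then obtain N where "\<And>n. n \<ge> N \<Longrightarrow> \<bar>nrm V (s n - l)\<bar> < \<epsilon>"
        using LIMSEQ_D[OF l(2)] by force
      then show "\<exists>N. \<forall>n\<ge>N. s n \<in> car V \<and> ndist V (s n) l < \<epsilon>"
        using s(1) l(1) by (auto simp: ndist_def intro!: exI[of _ N]) (smt (verit))
    qed (fact l(1))
    then show "\<exists>x. limitin M.mtopology s x sequentially" ..
  qed
  then show ?thesis
    using V by (simp add: banach_space_def norm_metric_def M.mcomplete_of)
qed

locale evaluation_space =
  fixes V :: "('i \<Rightarrow> real) nspace"
  assumes V: "normed_space V"
    and ev: "\<And>i. \<exists>K. \<forall>v\<in>car V. \<bar>v i\<bar> \<le> K * nrm V v"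
    and norming: "\<And>v. v \<in> car V \<Longrightarrow> \<exists>i. v i = nrm V v \<and> (\<forall>w\<in>car V. \<bar>w i\<bar> \<le> nrm V w)"
begin

lemmas N = normed_space_D[OF V]
lemmas closed = subspace_diff[OF N(1)] subspace_add[OF N(1)] subspace_scale[OF N(1)] subspace_0[OF N(1)]

definition "C = \<lparr>car = {m. \<exists>s. cauchy_limit V s m},
  nrm = (\<lambda>m. THE r. \<exists>s. cauchy_limit V s m \<and> (\<lambda>n. nrm V (s n)) \<longlonglongrightarrow> r)\<rparr>"

lemma cauchy_limit_iff:
  "cauchy_limit V s m \<longleftrightarrow> (\<forall>n. s n \<in> car V) \<and>
     (\<forall>\<epsilon>>0. \<exists>N. \<forall>n\<ge>N. \<forall>k\<ge>N. nrm V (s n - s k) < \<epsilon>) \<and> (\<forall>i. (\<lambda>n. s n i) \<longlonglongrightarrow> m i)"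
  by (auto simp: cauchy_limit_def MCauchy_ndist[OF V])

lemma cl_car: "cauchy_limit V s m \<Longrightarrow> s n \<in> car V"
  by (simp add: cauchy_limit_iff)

lemma cl_tends: "cauchy_limit V s m \<Longrightarrow> (\<lambda>n. s n i) \<longlonglongrightarrow> m i"
  by (simp add: cauchy_limit_iff)

lemma cl_cauchy:
  assumes "cauchy_limit V s m" "\<epsilon> > 0"
  obtains N where "\<And>n k. n \<ge> N \<Longrightarrow> k \<ge> N \<Longrightarrow> nrm V (s n - s k) < \<epsilon>"
  using assms unfolding cauchy_limit_iff by blast

lemma cl_add:
  assumes "cauchy_limit V s m" "cauchy_limit V s' m'"
  shows "cauchy_limit V (\<lambda>n. s n + s' n) (m + m')"
  unfolding cauchy_limit_iff
proof (intro conjI allI impI)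
  fix \<epsilon> :: real assume e: "\<epsilon> > 0"
  note a = assms[unfolded cauchy_limit_iff]
  obtain N1 N2 where N1: "\<And>n k. n \<ge> N1 \<Longrightarrow> k \<ge> N1 \<Longrightarrow> nrm V (s n - s k) < \<epsilon>/2"
    and N2: "\<And>n k. n \<ge> N2 \<Longrightarrow> k \<ge> N2 \<Longrightarrow> nrm V (s' n - s' k) < \<epsilon>/2"
    using a e half_gt_zero by meson
  have "nrm V (s n + s' n - (s k + s' k)) < \<epsilon>" if "n \<ge> max N1 N2" "k \<ge> max N1 N2" for n k
  proof -
    have "nrm V ((s n - s k) + (s' n - s' k)) \<le> nrm V (s n - s k) + nrm V (s' n - s' k)"
      using a by (intro N) (auto intro: closed)
    also have "\<dots> < \<epsilon>" using N1[of n k] N2[of n k] that by simp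
    finally show ?thesis by (simp add: algebra_simps)
  qed
  then show "\<exists>N. \<forall>n\<ge>N. \<forall>k\<ge>N. nrm V (s n + s' n - (s k + s' k)) < \<epsilon>" by blast
qed (use assms in \<open>auto simp: cauchy_limit_iff intro: closed tendsto_add\<close>)

lemma cl_scale:
  assumes "cauchy_limit V s m"
  shows "cauchy_limit V (\<lambda>n. c *\<^sub>R s n) (c *\<^sub>R m)"
  unfolding cauchy_limit_iff
proof (intro conjI allI impI)
  fix \<epsilon> :: real assume e: "\<epsilon> > 0"
  note a = assms[unfolded cauchy_limit_iff]
  have "\<epsilon> / (\<bar>c\<bar> + 1) > 0" using e by (simp add: add_nonneg_pos)
  then obtain N1 where N1: "\<And>n k. n \<ge> N1 \<Longrightarrow> k \<ge> N1 \<Longrightarrow> nrm V (s n - s k) < \<epsilon> / (\<bar>c\<bar> + 1)"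
    using a by meson
  have "nrm V (c *\<^sub>R s n - c *\<^sub>R s k) < \<epsilon>" if "n \<ge> N1" "k \<ge> N1" for n k
  proof -
    have "nrm V (c *\<^sub>R s n - c *\<^sub>R s k) = \<bar>c\<bar> * nrm V (s n - s k)"
      using a N(4)[of "s n - s k" c] closed by (simp add: algebra_simps)
    also have "\<dots> \<le> (\<bar>c\<bar> + 1) * nrm V (s n - s k)"
      using a N(2)[of "s n - s k"] closed by (simp add: mult_right_mono)
    also have "\<dots> < \<epsilon>" using N1[OF that] by (simp add: field_simps add_nonneg_pos)
    finally show ?thesis .
  qed
  then show "\<exists>N. \<forall>n\<ge>N. \<forall>k\<ge>N. nrm V (c *\<^sub>R s n - c *\<^sub>R s k) < \<epsilon>" by blast
qed (use assms in \<open>auto simp: cauchy_limit_iff intro: closed tendsto_mult_left\<close>)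

lemma cl_diff:
  assumes "cauchy_limit V s m" "cauchy_limit V s' m'"
  shows "cauchy_limit V (\<lambda>n. s n - s' n) (m - m')"
  using cl_add[OF assms(1) cl_scale[OF assms(2), of "-1"]] by simp

lemma cl_const: "v \<in> car V \<Longrightarrow> cauchy_limit V (\<lambda>n. v) v"
  using N(3)[of 0] closed by (simp add: cauchy_limit_iff)

lemma cl_null:
  assumes "cauchy_limit V s 0"
  shows "(\<lambda>n. nrm V (s n)) \<longlonglongrightarrow> 0"
proof (rule LIMSEQ_I)
  fix \<epsilon> :: real assume e: "\<epsilon> > 0"
  note a = cl_car[OF assms]
  obtain M where M: "\<And>n k. n \<ge> M \<Longrightarrow> k \<ge> M \<Longrightarrow> nrm V (s n - s k) < \<epsilon>/2"
    using cl_cauchy[OF assms half_gt_zero[OF e]] by blast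
  have "nrm V (s n) \<le> \<epsilon>/2" if n: "n \<ge> M" for n
  proof -
    obtain i where i: "s n i = nrm V (s n)" "\<And>w. w \<in> car V \<Longrightarrow> \<bar>w i\<bar> \<le> nrm V w"
      using norming[OF a[of n]] by blast
    have "(\<lambda>k. s n i - s k i) \<longlonglongrightarrow> s n i - 0"
      using cl_tends[OF assms, of i] by (intro tendsto_diff) auto
    moreover have "s n i - s k i \<le> \<epsilon>/2" if k: "k \<ge> M" for k
    proof -
      have "\<bar>(s n - s k) i\<bar> \<le> nrm V (s n - s k)" by (rule i(2)[OF closed(1)[OF a a]])
      then show ?thesis using M[OF n k] by simp
    qed
    ultimately have "s n i - 0 \<le> \<epsilon>/2" by - (rule LIMSEQ_le_const2, assumption, blast)
    then show ?thesis using i by simp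
  qed
  then show "\<exists>M. \<forall>n\<ge>M. norm (nrm V (s n) - 0) < \<epsilon>"
    using e N(2)[OF a] by (intro exI[of _ M]) force
qed

lemma nrm_C:
  assumes "cauchy_limit V s m"
  shows "(\<lambda>n. nrm V (s n)) \<longlonglongrightarrow> nrm C m"
proof -
  note a = cl_car[OF assms]
  have "Cauchy (\<lambda>n. nrm V (s n))"
  proof (rule CauchyI)
    fix \<epsilon> :: real assume e: "\<epsilon> > 0"
    obtain M where M: "\<And>n k. n \<ge> M \<Longrightarrow> k \<ge> M \<Longrightarrow> nrm V (s n - s k) < \<epsilon>"
      using cl_cauchy[OF assms e] by blast
    show "\<exists>M. \<forall>m\<ge>M. \<forall>n\<ge>M. norm (nrm V (s m) - nrm V (s n)) < \<epsilon>"
    proof (intro exI[of _ M] allI impI)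
      fix n k assume nk: "n \<ge> M" "k \<ge> M"
      have "\<bar>nrm V (s n) - nrm V (s k)\<bar> \<le> nrm V (s n - s k)" using a by (intro N(8)) auto
      then show "norm (nrm V (s n) - nrm V (s k)) < \<epsilon>" using M[OF nk] by simp
    qed
  qed
  then obtain r where r: "(\<lambda>n. nrm V (s n)) \<longlonglongrightarrow> r"
    using convergentD real_Cauchy_convergent by blast
  have "nrm C m = r"
    unfolding C_def nspace.simps
  proof (rule the_equality)
    show "\<exists>s. cauchy_limit V s m \<and> (\<lambda>n. nrm V (s n)) \<longlonglongrightarrow> r" using assms r by blast
    fix r' assume "\<exists>s. cauchy_limit V s m \<and> (\<lambda>n. nrm V (s n)) \<longlonglongrightarrow> r'"
    then obtain s' where s': "cauchy_limit V s' m" "(\<lambda>n. nrm V (s' n)) \<longlonglongrightarrow> r'" by blast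
    have "(\<lambda>n. nrm V (s' n - s n)) \<longlonglongrightarrow> 0"
      using cl_diff[OF s'(1) assms] by (intro cl_null) simp
    then have "(\<lambda>n. nrm V (s' n) - nrm V (s n)) \<longlonglongrightarrow> 0"
      by (rule tendsto_rabs_zero_cancel[OF tendsto_sandwich[of "\<lambda>_. 0", rotated 2, OF tendsto_const]])
        (use N(8)[OF cl_car[OF s'(1)] a] in auto)
    moreover have "(\<lambda>n. nrm V (s' n) - nrm V (s n)) \<longlonglongrightarrow> r' - r"
      by (intro tendsto_diff s' r)
    ultimately show "r' = r" using LIMSEQ_unique by fastforce
  qed
  then show ?thesis using r by simp
qed

lemma nrm_C_le:
  assumes "cauchy_limit V s m" "\<And>n. n \<ge> M \<Longrightarrow> nrm V (s n) \<le> K"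
  shows "nrm C m \<le> K"
  by (rule LIMSEQ_le_const2[OF nrm_C[OF assms(1)]]) (use assms(2) in blast)

lemma car_C: "m \<in> car C \<longleftrightarrow> (\<exists>s. cauchy_limit V s m)"
  by (simp add: C_def)

lemma nrm_C_extends: "v \<in> car V \<Longrightarrow> v \<in> car C \<and> nrm C v = nrm V v"
proof -
  assume v: "v \<in> car V"
  have "nrm V v = nrm C v"
    using nrm_C[OF cl_const[OF v]] by (simp add: LIMSEQ_const_iff)
  then show "v \<in> car C \<and> nrm C v = nrm V v" using cl_const[OF v] car_C by auto
qed

lemma normed_C: "normed_space C"
  unfolding normed_space_def norm_on_def
proof (intro conjI ballI allI)
  show "subspace (car C)"
  proof (rule subspaceI)
    show "0 \<in> car C" using nrm_C_extends closed by blast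
    show "x + y \<in> car C" if "x \<in> car C" "y \<in> car C" for x y
      using that cl_add unfolding car_C by metis
    show "c *\<^sub>R x \<in> car C" if "x \<in> car C" for c x
      using that cl_scale unfolding car_C by metis
  qed
next
  fix m assume "m \<in> car C"
  then obtain s where s: "cauchy_limit V s m" by (auto simp: car_C)
  note a = cl_car[OF s]
  show "0 \<le> nrm C m"
    by (rule LIMSEQ_le_const[OF nrm_C[OF s]]) (use N(2) a in auto)
  show "nrm C m = 0 \<longleftrightarrow> m = 0"
  proof
    assume z: "nrm C m = 0"
    show "m = 0"
    proof
      fix i
      obtain K where K: "\<And>v. v \<in> car V \<Longrightarrow> \<bar>v i\<bar> \<le> K * nrm V v" using ev by blast
      have "(\<lambda>n. K * nrm V (s n)) \<longlonglongrightarrow> K * 0"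
        using nrm_C[OF s] z by (intro tendsto_mult_left) simp
      then have l0: "(\<lambda>n. K * nrm V (s n)) \<longlonglongrightarrow> 0" by simp
      have "(\<lambda>n. s n i) \<longlonglongrightarrow> 0"
        by (rule Lim_null_comparison[OF always_eventually l0]) (simp add: K[OF a])
      then show "m i = 0 i" using LIMSEQ_unique[OF cl_tends[OF s, of i]] by simp
    qed
  next
    assume "m = 0"
    then show "nrm C m = 0" using nrm_C_extends[of 0] N(3)[of 0] closed by simp
  qed
  show "nrm C (c *\<^sub>R m) = \<bar>c\<bar> * nrm C m" for c
  proof (rule LIMSEQ_unique[OF nrm_C[OF cl_scale[OF s]]])
    show "(\<lambda>n. nrm V (c *\<^sub>R s n)) \<longlonglongrightarrow> \<bar>c\<bar> * nrm C m"
      using tendsto_mult_left[OF nrm_C[OF s], of "\<bar>c\<bar>"] N(4)[OF a] by simp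
  qed
  fix m' assume "m' \<in> car C"
  then obtain s' where s': "cauchy_limit V s' m'" by (auto simp: car_C)
  show "nrm C (m + m') \<le> nrm C m + nrm C m'"
    by (rule LIMSEQ_le[OF nrm_C[OF cl_add[OF s s']] tendsto_add[OF nrm_C[OF s] nrm_C[OF s']]])
      (use N(5)[OF a cl_car[OF s']] in auto)
qed

lemma C_dense:
  assumes s: "cauchy_limit V s m" and e: "\<epsilon> > 0"
  shows "\<exists>M. \<forall>n\<ge>M. nrm C (m - s n) < \<epsilon>"
proof -
  note a = cl_car[OF s]
  obtain M where M: "\<And>n k. n \<ge> M \<Longrightarrow> k \<ge> M \<Longrightarrow> nrm V (s n - s k) < \<epsilon>/2"
    using cl_cauchy[OF s half_gt_zero[OF e]] by blast
  have "nrm C (m - s n) \<le> \<epsilon>/2" if n: "n \<ge> M" for n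
    by (rule nrm_C_le[OF cl_diff[OF s cl_const]]) (use a M n in \<open>auto intro: less_imp_le\<close>)
  then show ?thesis using e by (intro exI[of _ M]) force
qed

lemma banach_C: "banach_space C"
proof (rule banach_spaceI[OF normed_C])
  note NC = normed_space_D[OF normed_C]
  fix s :: "nat \<Rightarrow> _" assume s: "\<And>n. s n \<in> car C"
    and cau: "\<And>\<epsilon>. \<epsilon> > 0 \<Longrightarrow> \<exists>N. \<forall>n\<ge>N. \<forall>k\<ge>N. nrm C (s n - s k) < \<epsilon>"
  have "\<exists>v\<in>car V. nrm C (s n - v) < 1 / Suc n" for n
  proof -
    obtain t where t: "cauchy_limit V t (s n)" using s car_C by blast
    then show ?thesis using C_dense[OF t, of "1 / Suc n"] by (auto simp: cauchy_limit_iff)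
  qed
  then obtain v where v: "\<And>n. v n \<in> car V" "\<And>n. nrm C (s n - v n) < 1 / Suc n" by metis
  have vC: "v n \<in> car C" for n using v nrm_C_extends by blast
  have vc: "\<exists>M. \<forall>n\<ge>M. \<forall>k\<ge>M. nrm V (v n - v k) < \<epsilon>" if e: "\<epsilon> > 0" for \<epsilon>
  proof -
    obtain M1 where M1: "\<And>n k. n \<ge> M1 \<Longrightarrow> k \<ge> M1 \<Longrightarrow> nrm C (s n - s k) < \<epsilon>/3"
      using cau[of "\<epsilon>/3"] e by auto
    obtain M2 where M2: "inverse (real (Suc M2)) < \<epsilon>/3" using reals_Archimedean[of "\<epsilon>/3"] e by auto
    have sm: "nrm C (s n - v n) < \<epsilon>/3" if "n \<ge> M2" for n
    proof -
      have "1 / real (Suc n) \<le> inverse (real (Suc M2))" using that by (simp add: divide_simps)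
      then show ?thesis using v(2)[of n] M2 by simp
    qed
    have "nrm V (v n - v k) < \<epsilon>" if nk: "n \<ge> max M1 M2" "k \<ge> max M1 M2" for n k
    proof -
      have "v n - v k = ((s n - s k) - (s n - v n)) + (s k - v k)" by simp
      moreover have "nrm C \<dots> \<le> nrm C ((s n - s k) - (s n - v n)) + nrm C (s k - v k)"
        using s vC NC(1) by (intro NC(5)) (auto intro!: subspace_diff)
      moreover have "nrm C ((s n - s k) - (s n - v n)) \<le> nrm C (s n - s k) + nrm C (s n - v n)"
        using s vC NC(1) by (intro NC(6)) (auto intro!: subspace_diff)
      ultimately have "nrm C (v n - v k) < \<epsilon>" using M1[of n k] sm[of n] sm[of k] nk by simp
      then show ?thesis using nrm_C_extends[OF closed(1)[OF v(1) v(1), of n k]] by simp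
    qed
    then show ?thesis by blast
  qed
  have "\<exists>l. (\<lambda>n. v n i) \<longlonglongrightarrow> l" for i
  proof -
    obtain K where K: "\<And>w. w \<in> car V \<Longrightarrow> \<bar>w i\<bar> \<le> K * nrm V w" using ev by blast
    have "Cauchy (\<lambda>n. v n i)"
    proof (rule CauchyI)
      fix \<epsilon> :: real assume e: "\<epsilon> > 0"
      then have "\<epsilon> / (\<bar>K\<bar> + 1) > 0" by (simp add: add_nonneg_pos)
      then obtain M where M: "\<And>n k. n \<ge> M \<Longrightarrow> k \<ge> M \<Longrightarrow> nrm V (v n - v k) < \<epsilon> / (\<bar>K\<bar> + 1)"
        using vc[of "\<epsilon> / (\<bar>K\<bar> + 1)"] by blast
      have "norm (v n i - v k i) < \<epsilon>" if "n \<ge> M" "k \<ge> M" for n k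
      proof -
        have "\<bar>(v n - v k) i\<bar> \<le> K * nrm V (v n - v k)" by (rule K[OF closed(1)[OF v(1) v(1)]])
        also have "\<dots> \<le> (\<bar>K\<bar> + 1) * nrm V (v n - v k)"
          using N(2)[OF closed(1)[OF v(1) v(1)]] by (intro mult_right_mono) auto
        also have "\<dots> < \<epsilon>" using M[OF that] by (simp add: field_simps add_nonneg_pos)
        finally show ?thesis by simp
      qed
      then show "\<exists>M. \<forall>n\<ge>M. \<forall>k\<ge>M. norm (v n i - v k i) < \<epsilon>" by blast
    qed
    then show ?thesis using real_Cauchy_convergent convergentD by blast
  qed
  then obtain l where "\<And>i. (\<lambda>n. v n i) \<longlonglongrightarrow> l i" by metis
  then have cl: "cauchy_limit V v l" using v vc by (auto simp: cauchy_limit_iff)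
  then have lC: "l \<in> car C" by (auto simp: car_C)
  have "(\<lambda>n. nrm C (s n - l)) \<longlonglongrightarrow> 0"
  proof (rule LIMSEQ_I)
    fix \<epsilon> :: real assume e: "\<epsilon> > 0"
    obtain M1 where M1: "\<And>n. n \<ge> M1 \<Longrightarrow> nrm C (l - v n) < \<epsilon>/2" using C_dense[OF cl, of "\<epsilon>/2"] e by auto
    obtain M2 where M2: "inverse (real (Suc M2)) < \<epsilon>/2" using reals_Archimedean[of "\<epsilon>/2"] e by auto
    have "norm (nrm C (s n - l) - 0) < \<epsilon>" if n: "n \<ge> max M1 M2" for n
    proof -
      have "1 / real (Suc n) \<le> inverse (real (Suc M2))" using n by (simp add: divide_simps)
      then have "nrm C (s n - v n) < \<epsilon>/2" using v(2)[of n] M2 by simp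
      moreover have "nrm C ((s n - v n) - (l - v n)) \<le> nrm C (s n - v n) + nrm C (l - v n)"
        using s vC lC NC(1) by (intro NC(6)) (auto intro!: subspace_diff)
      moreover have "0 \<le> nrm C (s n - l)" using s lC NC(1) by (intro NC(2)) (auto intro!: subspace_diff)
      ultimately show ?thesis using M1[of n] n by simp
    qed
    then show "\<exists>M. \<forall>n\<ge>M. norm (nrm C (s n - l) - 0) < \<epsilon>" by blast
  qed
  then show "\<exists>l\<in>car C. (\<lambda>n. nrm C (s n - l)) \<longlonglongrightarrow> 0" using lC by blast
qed

lemma completion_C: "is_completion V C"
  unfolding is_completion_def
proof (intro conjI ballI allI impI)
  fix c and \<epsilon> :: real assume "c \<in> car C" "\<epsilon> > 0"
  then obtain s where "cauchy_limit V s c" by (auto simp: car_C)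
  then show "\<exists>v\<in>car V. nrm C (c - v) < \<epsilon>"
    using C_dense[of s c \<epsilon>] \<open>\<epsilon> > 0\<close> by (auto simp: cauchy_limit_iff)
qed (use banach_C nrm_C_extends in auto)

end

subsection \<open>Molecules\<close>

lemma normed_real_line: "normed_space real_line"
  by (auto simp: normed_space_def norm_on_def real_line_def abs_mult)

lemma norm_metric:
  assumes "normed_space V"
  shows "mspace (norm_metric V) = car V" "mdist (norm_metric V) = ndist V"
proof -
  interpret Metric_space "car V" "ndist V" by (rule Metric_space_ndist[OF assms])
  show "mspace (norm_metric V) = car V" "mdist (norm_metric V) = ndist V"
    by (simp_all add: norm_metric_def)
qed

lemma lip_dual_iff:
  "f \<in> car (lip_dual X z) \<longleftrightarrow>
     (\<exists>C. \<forall>x\<in>mspace X. \<forall>y\<in>mspace X. \<bar>f x - f y\<bar> \<le> C * mdist X x y) \<and> f z = 0 \<and>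
     (\<forall>x. x \<notin> mspace X \<longrightarrow> f x = 0)"
proof -
  have "mspace (norm_metric real_line) = UNIV" "mdist (norm_metric real_line) a b = \<bar>a - b\<bar>" for a b
    by (simp_all add: norm_metric[OF normed_real_line]) (simp_all add: ndist_def real_line_def)
  then show ?thesis by (simp add: lip_dual_def Lip0_def Lipschitz_continuous_map_def)
qed

definition "rep X z m r \<longleftrightarrow> (\<exists>(n::nat) c x y. r = (\<Sum>i<n. \<bar>c i\<bar> * mdist X (x i) (y i)) \<and>
  (\<forall>i<n. x i \<in> mspace X \<and> y i \<in> mspace X) \<and> m = (\<Sum>i<n. c i *\<^sub>R delta X z (x i) (y i)))"

lemma rep_0: "rep X z 0 0"
  unfolding rep_def by (rule exI[of _ 0]) simp

lemma rep_delta: "x \<in> mspace X \<Longrightarrow> y \<in> mspace X \<Longrightarrow> rep X z (delta X z x y) (mdist X x y)"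
  unfolding rep_def
  by (rule exI[of _ 1], rule exI[of _ "\<lambda>_. 1"], rule exI[of _ "\<lambda>_. x"], rule exI[of _ "\<lambda>_. y"]) simp

lemma rep_scale: "rep X z m r \<Longrightarrow> rep X z (a *\<^sub>R m) (\<bar>a\<bar> * r)"
proof -
  assume "rep X z m r"
  then obtain n c x y where r: "r = (\<Sum>i<(n::nat). \<bar>c i\<bar> * mdist X (x i) (y i))"
    "\<forall>i<n. x i \<in> mspace X \<and> y i \<in> mspace X" "m = (\<Sum>i<n. c i *\<^sub>R delta X z (x i) (y i))"
    unfolding rep_def by blast
  show ?thesis
    unfolding rep_def
    by (rule exI[of _ n], rule exI[of _ "\<lambda>i. a * c i"], rule exI[of _ x], rule exI[of _ y])
      (use r in \<open>simp add: sum_distrib_left scaleR_sum_right abs_mult mult.assoc\<close>)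
qed

lemma sum_append:
  "(\<Sum>i<n + m. if i < n then f i else g (i - n)) = (\<Sum>i<n. f i) + (\<Sum>i<m::nat. g i)"
  for f g :: "nat \<Rightarrow> 'b::comm_monoid_add"
  by (induction m) (simp_all add: add.assoc)

lemma rep_add:
  assumes "rep X z m r" "rep X z m' r'"
  shows "rep X z (m + m') (r + r')"
proof -
  obtain n c x y where r: "r = (\<Sum>i<(n::nat). \<bar>c i\<bar> * mdist X (x i) (y i))"
    "\<forall>i<n. x i \<in> mspace X \<and> y i \<in> mspace X" "m = (\<Sum>i<n. c i *\<^sub>R delta X z (x i) (y i))"
    using assms(1) unfolding rep_def by blast
  obtain n' c' x' y' where r': "r' = (\<Sum>i<(n'::nat). \<bar>c' i\<bar> * mdist X (x' i) (y' i))"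
    "\<forall>i<n'. x' i \<in> mspace X \<and> y' i \<in> mspace X" "m' = (\<Sum>i<n'. c' i *\<^sub>R delta X z (x' i) (y' i))"
    using assms(2) unfolding rep_def by blast
  show ?thesis
    unfolding rep_def
  proof (rule exI[of _ "n + n'"], rule exI[of _ "\<lambda>i. if i < n then c i else c' (i - n)"],
      rule exI[of _ "\<lambda>i. if i < n then x i else x' (i - n)"],
      rule exI[of _ "\<lambda>i. if i < n then y i else y' (i - n)"], intro conjI)
    show "r + r' = (\<Sum>i<n + n'. \<bar>if i < n then c i else c' (i - n)\<bar> *
       mdist X (if i < n then x i else x' (i - n)) (if i < n then y i else y' (i - n)))"
      unfolding r r' sum_append[symmetric] by (rule sum.cong) auto
    show "m + m' = (\<Sum>i<n + n'. (if i < n then c i else c' (i - n)) *\<^sub>R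
       delta X z (if i < n then x i else x' (i - n)) (if i < n then y i else y' (i - n)))"
      unfolding r r' sum_append[symmetric] by (rule sum.cong) auto
  qed (use r r' in auto)
qed

lemma car_molecules: "m \<in> car (molecules X z) \<longleftrightarrow> (\<exists>r. rep X z m r)"
proof
  assume "m \<in> car (molecules X z)"
  then have "m \<in> span {delta X z x y | x y. x \<in> mspace X \<and> y \<in> mspace X}"
    by (simp add: molecules_def)
  then show "\<exists>r. rep X z m r"
  proof (rule span_induct_alt)
    show "\<exists>r. rep X z 0 r" by (rule exI, rule rep_0)
    fix c d m assume "d \<in> {delta X z x y | x y. x \<in> mspace X \<and> y \<in> mspace X}" "\<exists>r. rep X z m r"
    then obtain x y r where "d = delta X z x y" "x \<in> mspace X" "y \<in> mspace X" "rep X z m r" by blast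
    then have "rep X z (c *\<^sub>R d + m) (\<bar>c\<bar> * mdist X x y + r)"
      by (simp add: rep_add rep_scale rep_delta)
    then show "\<exists>r. rep X z (c *\<^sub>R d + m) r" by (rule exI)
  qed
next
  assume "\<exists>r. rep X z m r"
  then show "m \<in> car (molecules X z)"
    unfolding rep_def molecules_def nspace.simps
    by clarify (intro span_sum span_scale, rule span_base, blast)
qed

lemma nrm_molecules: "nrm (molecules X z) m = Inf {r. rep X z m r}"
  by (simp add: molecules_def rep_def)

lemma rep_nonneg: "rep X z m r \<Longrightarrow> 0 \<le> r"
  by (auto simp: rep_def intro!: sum_nonneg)

lemma nrm_le: "rep X z m r \<Longrightarrow> nrm (molecules X z) m \<le> r"
  unfolding nrm_molecules by (rule cInf_lower) (auto intro: bdd_belowI rep_nonneg)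

lemma nrm_ge: "m \<in> car (molecules X z) \<Longrightarrow> (\<And>r. rep X z m r \<Longrightarrow> a \<le> r) \<Longrightarrow> a \<le> nrm (molecules X z) m"
  unfolding nrm_molecules by (rule cInf_greatest) (auto simp: car_molecules)

lemma molecule_bound: "\<exists>K. \<forall>m\<in>car (molecules X z). \<bar>m f\<bar> \<le> K * nrm (molecules X z) m"
proof -
  have "\<exists>K>0. \<forall>x\<in>mspace X. \<forall>y\<in>mspace X. \<bar>delta X z x y f\<bar> \<le> K * mdist X x y"
  proof (cases "f \<in> car (lip_dual X z)")
    case True
    then obtain C where C: "\<And>x y. x \<in> mspace X \<Longrightarrow> y \<in> mspace X \<Longrightarrow> \<bar>f x - f y\<bar> \<le> C * mdist X x y"
      unfolding lip_dual_iff by blast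
    have "\<bar>delta X z x y f\<bar> \<le> (\<bar>C\<bar> + 1) * mdist X x y" if "x \<in> mspace X" "y \<in> mspace X" for x y
    proof -
      have "C * mdist X x y \<le> (\<bar>C\<bar> + 1) * mdist X x y" by (intro mult_right_mono) auto
      then show ?thesis using C[OF that] True by (simp add: delta_def)
    qed
    moreover have "\<bar>C\<bar> + 1 > 0" by simp
    ultimately show ?thesis by blast
  next
    case False
    then show ?thesis by (intro exI[of _ 1]) (simp add: delta_def)
  qed
  then obtain K where K: "K > 0"
    "\<And>x y. x \<in> mspace X \<Longrightarrow> y \<in> mspace X \<Longrightarrow> \<bar>delta X z x y f\<bar> \<le> K * mdist X x y" by blast
  have "\<bar>m f\<bar> \<le> K * nrm (molecules X z) m" if m: "m \<in> car (molecules X z)" for m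
  proof -
    have "\<bar>m f\<bar> / K \<le> nrm (molecules X z) m"
    proof (rule nrm_ge[OF m])
      fix r assume "rep X z m r"
      then obtain n c x y where r: "r = (\<Sum>i<(n::nat). \<bar>c i\<bar> * mdist X (x i) (y i))"
        "\<forall>i<n. x i \<in> mspace X \<and> y i \<in> mspace X" "m = (\<Sum>i<n. c i *\<^sub>R delta X z (x i) (y i))"
        unfolding rep_def by blast
      have ap: "(\<Sum>i<k. h i) f = (\<Sum>i<k. h i f)" for h :: "nat \<Rightarrow> ('a \<Rightarrow> real) \<Rightarrow> real" and k
        by (induction k) simp_all
      have "\<bar>m f\<bar> \<le> (\<Sum>i<n. \<bar>c i * delta X z (x i) (y i) f\<bar>)"
        unfolding r(3) ap by (simp add: sum_abs)
      also have "\<dots> \<le> (\<Sum>i<n. K * (\<bar>c i\<bar> * mdist X (x i) (y i)))"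
      proof (rule sum_mono)
        fix i assume "i \<in> {..<n}"
        then have "\<bar>delta X z (x i) (y i) f\<bar> \<le> K * mdist X (x i) (y i)" using r(2) K by auto
        then have "\<bar>c i\<bar> * \<bar>delta X z (x i) (y i) f\<bar> \<le> \<bar>c i\<bar> * (K * mdist X (x i) (y i))"
          by (rule mult_left_mono) simp
        then show "\<bar>c i * delta X z (x i) (y i) f\<bar> \<le> K * (\<bar>c i\<bar> * mdist X (x i) (y i))"
          by (simp add: abs_mult mult_ac)
      qed
      also have "\<dots> = K * r" by (simp add: r sum_distrib_left)
      finally show "\<bar>m f\<bar> / K \<le> r" using K(1) by (simp add: field_simps)
    qed
    then show ?thesis using K(1) by (simp add: field_simps)
  qed
  then show ?thesis by blast
qed

lemma normed_molecules: "normed_space (molecules X z)"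
  unfolding normed_space_def norm_on_def
proof (intro conjI ballI allI)
  show "subspace (car (molecules X z))" by (simp add: molecules_def)
  fix m assume m: "m \<in> car (molecules X z)"
  show "0 \<le> nrm (molecules X z) m" using m rep_nonneg by (rule nrm_ge)
  show "nrm (molecules X z) m = 0 \<longleftrightarrow> m = 0"
  proof
    assume 0: "nrm (molecules X z) m = 0"
    show "m = 0"
    proof
      fix f
      obtain K where "\<forall>m\<in>car (molecules X z). \<bar>m f\<bar> \<le> K * nrm (molecules X z) m"
        using molecule_bound by (rule exE)
      from bspec[OF this m] show "m f = 0 f" using 0 by simp
    qed
  next
    assume "m = 0"
    then show "nrm (molecules X z) m = 0"
      using nrm_le[OF rep_0, of X z] \<open>0 \<le> nrm (molecules X z) m\<close> by simp
  qed
  have le: "nrm (molecules X z) (c *\<^sub>R m) \<le> \<bar>c\<bar> * nrm (molecules X z) m"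
    if m: "m \<in> car (molecules X z)" and c: "c \<noteq> 0" for c m
  proof -
    have "nrm (molecules X z) (c *\<^sub>R m) / \<bar>c\<bar> \<le> nrm (molecules X z) m"
    proof (rule nrm_ge[OF m])
      fix r assume "rep X z m r"
      then show "nrm (molecules X z) (c *\<^sub>R m) / \<bar>c\<bar> \<le> r"
        using nrm_le[OF rep_scale] c by (simp add: field_simps)
    qed
    then show ?thesis using c by (simp add: field_simps)
  qed
  show "nrm (molecules X z) (c *\<^sub>R m) = \<bar>c\<bar> * nrm (molecules X z) m" for c
  proof (cases "c = 0")
    case True
    have "0 \<in> car (molecules X z)" unfolding car_molecules by (rule exI, rule rep_0)
    then have "0 \<le> nrm (molecules X z) 0" by (rule nrm_ge) (rule rep_nonneg)
    then show ?thesis using True nrm_le[OF rep_0, of X z] by simp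
  next
    case False
    have "c *\<^sub>R m \<in> car (molecules X z)" using m unfolding car_molecules by (elim exE) (rule exI, erule rep_scale)
    then have "nrm (molecules X z) ((1 / c) *\<^sub>R (c *\<^sub>R m)) \<le> \<bar>1 / c\<bar> * nrm (molecules X z) (c *\<^sub>R m)"
      using False by (intro le) auto
    then show ?thesis using le[OF m False] False by (simp add: field_simps)
  qed
  fix m' assume m': "m' \<in> car (molecules X z)"
  have "nrm (molecules X z) (m + m') - r' \<le> nrm (molecules X z) m" if r': "rep X z m' r'" for r'
  proof (rule nrm_ge[OF m])
    fix r assume "rep X z m r"
    then show "nrm (molecules X z) (m + m') - r' \<le> r" using nrm_le[OF rep_add[OF _ r']] by fastforce
  qed
  then have "nrm (molecules X z) (m + m') - nrm (molecules X z) m \<le> nrm (molecules X z) m'"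
    by (intro nrm_ge[OF m']) (smt (verit))
  then show "nrm (molecules X z) (m + m') \<le> nrm (molecules X z) m + nrm (molecules X z) m'" by simp
qed

lemma molecules_norming:
  assumes z: "z \<in> mspace X" and v: "v \<in> car (molecules X z)"
  shows "\<exists>f. v f = nrm (molecules X z) v \<and> (\<forall>w\<in>car (molecules X z). \<bar>w f\<bar> \<le> nrm (molecules X z) w)"
proof -
  obtain \<phi> where lin: "linear \<phi>"
    and le: "\<And>x. x \<in> car (molecules X z) \<Longrightarrow> \<bar>\<phi> x\<bar> \<le> nrm (molecules X z) x"
    and v': "\<phi> v = nrm (molecules X z) v"
    using hahn_banach_norming[OF normed_molecules v] by blast
  define f where "f x = (if x \<in> mspace X then \<phi> (delta X z x z) else 0)" for x
  have d: "f x - f y = \<phi> (delta X z x y)" if "x \<in> mspace X" "y \<in> mspace X" for x y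
  proof -
    have "delta X z x y = delta X z x z - delta X z y z" by (auto simp: delta_def fun_eq_iff)
    then show ?thesis using that linear_diff[OF lin] by (simp add: f_def)
  qed
  have "\<bar>f x - f y\<bar> \<le> 1 * mdist X x y" if xy: "x \<in> mspace X" "y \<in> mspace X" for x y
  proof -
    have "delta X z x y \<in> car (molecules X z)" unfolding car_molecules by (rule exI, rule rep_delta[OF xy])
    from le[OF this] show ?thesis using nrm_le[OF rep_delta[OF xy, of z]] d[OF xy] by simp
  qed
  moreover have "f z = 0" using d[OF z z] linear_0[OF lin]
    by (simp add: f_def delta_def zero_fun_def cong: if_cong)
  ultimately have f: "f \<in> car (lip_dual X z)"
    unfolding lip_dual_iff by (intro conjI exI[of _ 1] ballI allI) (auto simp only: f_def if_False)
  have "w f = \<phi> w" if w: "w \<in> car (molecules X z)" for w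
  proof -
    have "w \<in> span {delta X z x y | x y. x \<in> mspace X \<and> y \<in> mspace X}"
      using w by (simp add: molecules_def)
    then show ?thesis
    proof (rule span_induct_alt)
      show "0 f = \<phi> 0" using linear_0[OF lin] by simp
      fix c e m assume "e \<in> {delta X z x y | x y. x \<in> mspace X \<and> y \<in> mspace X}" and m: "m f = \<phi> m"
      then obtain x y where "e = delta X z x y" "x \<in> mspace X" "y \<in> mspace X" by blast
      then have "e f = \<phi> e" using f d by (simp add: delta_def[of X z x y])
      then show "(c *\<^sub>R e + m) f = \<phi> (c *\<^sub>R e + m)"
        using m by (simp add: linear_add[OF lin] linear_scale[OF lin])
    qed
  qed
  then show ?thesis using v v' le by (intro exI[of _ f]) auto
qed

lemma lip_free_completion:
  assumes "z \<in> mspace X"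
  shows "is_completion (molecules X z) (lip_free X z)"
proof -
  interpret evaluation_space "molecules X z"
    by unfold_locales (use normed_molecules molecule_bound molecules_norming[OF assms] in auto)
  have "C = lip_free X z" by (simp add: C_def lip_free_def)
  then show ?thesis using completion_C by simp
qed

end

theory Submission
  imports Defs
begin

text \<open>
  Every Lipschitz map \<open>f : X \<rightarrow> E\<^sup>*\<close> vanishing at the base point gives a bilinear form
  \<open>B\<^sub>f (m, e) = m (x \<mapsto> f x e)\<close> on \<open>F(X) \<times> E\<close>: elements of the Lipschitz-free space are functionals on
  \<open>X\<^sup>#\<close>, and each slice \<open>x \<mapsto> f x e\<close> is in \<open>X\<^sup>#\<close>. An element of the algebraic tensor product is a
  functional on bilinear forms, so restricting it to the forms \<open>B\<^sub>f\<close> gives a linear map \<open>\<Psi>\<close> from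
  \<open>F(X) \<otimes> E\<close> into the functionals on \<open>Lip\<^sub>0(X; E\<^sup>*)\<close>. It carries the elementary tensor of \<open>\<delta>(x, y)\<close> and
  \<open>e\<close> to the elementary Lipschitz tensor of the same data, so its image contains the Lipschitz tensor
  product.

  The essential point is that \<open>\<Psi>\<close> is injective, although it uses only bounded forms and the tensor
  product sees all bilinear forms (lemma \<open>inj_on_to_lip_functional\<close>). If \<open>\<Psi>\<close> annihilates
  \<open>\<Sum>\<^sub>i m\<^sub>i \<otimes> e\<^sub>i\<close>, testing on the rank-one maps \<open>x \<mapsto> g x \<phi>\<close> and separating points of \<open>E\<close> by
  Hahn-Banach gives \<open>\<Sum>\<^sub>i m\<^sub>i(g) e\<^sub>i = 0\<close> for every \<open>g\<close>. Taking coordinates in a basis of the span of the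
  \<open>e\<^sub>i\<close> turns this into linear relations between the \<open>m\<^sub>i\<close>, which every bilinear form respects
  (lemma \<open>bilinear_sum_zero\<close>).

  Hence \<open>\<Psi>\<close> has a linear left inverse \<open>\<Phi>\<close>, which is the map of the theorem, and the Lipschitz norm
  is \<open>\<alpha>\<close> transported along \<open>\<Phi>\<close>; that \<open>\<Phi>\<close> is isometric is then its definition. The cross-norm
  identity rests on \<open>\<parallel>\<delta>(x, y)\<parallel> = d(x, y)\<close> (lemma \<open>delta_lip_free\<close>). Dualizability is the
  reasonableness of \<open>\<alpha>\<close> applied to the functional \<open>m \<mapsto> m(f)\<close> on \<open>F(X)\<close>, whose norm is at most
  the Lipschitz constant of \<open>f\<close> (lemma \<open>evaluation_in_dual\<close>).
\<close>

section \<open>Best constants\<close>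

text \<open>
  Operator norms and Lipschitz constants are both infima of this shape; the point is that the infimum
  is itself an admissible constant.
\<close>

lemma best_constant:
  fixes a b :: "'i \<Rightarrow> real"
  assumes ex: "\<exists>C. \<forall>i\<in>I. a i \<le> C * b i" and b: "\<And>i. i \<in> I \<Longrightarrow> 0 \<le> b i"
  defines "c \<equiv> Inf {C. 0 \<le> C \<and> (\<forall>i\<in>I. a i \<le> C * b i)}"
  shows "0 \<le> c" and "i \<in> I \<Longrightarrow> a i \<le> c * b i"
proof -
  let ?S = "{C. 0 \<le> C \<and> (\<forall>i\<in>I. a i \<le> C * b i)}"
  obtain C where C: "\<And>i. i \<in> I \<Longrightarrow> a i \<le> C * b i" using ex by blast
  (* C itself may be negative *)
  have "a i \<le> max C 0 * b i" if "i \<in> I" for i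
    using C[OF that] mult_right_mono[of C "max C 0" "b i"] b[OF that] by simp
  then have ne: "?S \<noteq> {}" by (intro ex_in_conv[THEN iffD1] exI[of _ "max C 0"]) simp
  show "0 \<le> c" unfolding c_def by (rule cInf_greatest[OF ne]) simp
  assume i: "i \<in> I"
  show "a i \<le> c * b i"
  proof (cases "b i = 0")
    case True
    then show ?thesis using C[OF i] by simp
  next
    case False
    then have pos: "0 < b i" using b[OF i] by simp
    have "a i / b i \<le> c"
      unfolding c_def by (rule cInf_greatest[OF ne]) (use i pos in \<open>simp add: pos_divide_le_eq\<close>)
    then show ?thesis using pos by (simp add: pos_divide_le_eq)
  qed
qed

lemma best_constant_le:
  fixes a b :: "'i \<Rightarrow> real"
  assumes "0 \<le> K" "\<And>i. i \<in> I \<Longrightarrow> a i \<le> K * b i"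
  shows "Inf {C. 0 \<le> C \<and> (\<forall>i\<in>I. a i \<le> C * b i)} \<le> K"
  by (rule cInf_lower) (use assms in \<open>auto intro: bdd_belowI\<close>)

lemma lip_const_conv:
  "lip_const X V f = Inf {C. 0 \<le> C \<and> (\<forall>p\<in>mspace X \<times> mspace X.
     (\<lambda>(x, y). nrm V (f x - f y)) p \<le> C * (\<lambda>(x, y). mdist X x y) p)}"
  by (simp add: lip_const_def)

section \<open>Dual spaces\<close>

lemma car_dual_iff:
  "\<phi> \<in> car (dual V) \<longleftrightarrow>
     (\<forall>x\<in>car V. \<forall>y\<in>car V. \<phi> (x + y) = \<phi> x + \<phi> y) \<and>
     (\<forall>x\<in>car V. \<forall>c. \<phi> (c *\<^sub>R x) = c * \<phi> x) \<and>
     (\<exists>K. \<forall>x\<in>car V. \<bar>\<phi> x\<bar> \<le> K * nrm V x) \<and> (\<forall>x. x \<notin> car V \<longrightarrow> \<phi> x = 0)"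
  by (auto simp: dual_def bounded_op_def linear_op_def real_line_def)

lemma nrm_dual: "nrm (dual V) \<phi> = Inf {K. 0 \<le> K \<and> (\<forall>x\<in>car V. \<bar>\<phi> x\<bar> \<le> K * nrm V x)}"
  by (simp add: dual_def op_norm_def real_line_def)

lemma nrm_dual_le:
  assumes "0 \<le> K" "\<And>x. x \<in> car V \<Longrightarrow> \<bar>\<phi> x\<bar> \<le> K * nrm V x"
  shows "nrm (dual V) \<phi> \<le> K"
  unfolding nrm_dual using assms by (rule best_constant_le)

lemma nrm_dual_bound:
  assumes V: "normed_space V" and \<phi>: "\<phi> \<in> car (dual V)"
  shows "0 \<le> nrm (dual V) \<phi>" and "x \<in> car V \<Longrightarrow> \<bar>\<phi> x\<bar> \<le> nrm (dual V) \<phi> * nrm V x"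
  unfolding nrm_dual
  by (rule best_constant; use normed_space_D(2)[OF V] \<phi> in \<open>auto simp: car_dual_iff\<close>)+

lemma subspace_dual:
  assumes "normed_space V"
  shows "subspace (car (dual V))"
proof (rule subspaceI)
  show "0 \<in> car (dual V)" by (auto simp: car_dual_iff intro!: exI[of _ 0])
next
  fix \<phi> \<psi> assume *: "\<phi> \<in> car (dual V)" "\<psi> \<in> car (dual V)"
  have "\<bar>(\<phi> + \<psi>) x\<bar> \<le> (nrm (dual V) \<phi> + nrm (dual V) \<psi>) * nrm V x" if "x \<in> car V" for x
    using nrm_dual_bound(2)[OF assms *(1) that] nrm_dual_bound(2)[OF assms *(2) that]
    by (simp add: distrib_right)
  then have "\<exists>K. \<forall>x\<in>car V. \<bar>(\<phi> + \<psi>) x\<bar> \<le> K * nrm V x" by blast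
  then show "\<phi> + \<psi> \<in> car (dual V)"
    using * unfolding car_dual_iff by (simp add: algebra_simps)
next
  fix c \<phi> assume *: "\<phi> \<in> car (dual V)"
  have "\<bar>(c *\<^sub>R \<phi>) x\<bar> \<le> (\<bar>c\<bar> * nrm (dual V) \<phi>) * nrm V x" if "x \<in> car V" for x
    using mult_left_mono[OF nrm_dual_bound(2)[OF assms * that], of "\<bar>c\<bar>"] by (simp add: abs_mult mult.assoc)
  then have "\<exists>K. \<forall>x\<in>car V. \<bar>(c *\<^sub>R \<phi>) x\<bar> \<le> K * nrm V x" by blast
  then show "c *\<^sub>R \<phi> \<in> car (dual V)"
    using * unfolding car_dual_iff by (simp add: algebra_simps)
qed

lemma normed_space_dual:
  assumes V: "normed_space V"
  shows "normed_space (dual V)"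
  unfolding normed_space_def norm_on_def
proof (intro conjI ballI allI)
  note S = subspace_dual[OF V]
  note bound = nrm_dual_bound[OF V]
  show "subspace (car (dual V))" by (rule S)
  fix \<phi> assume \<phi>: "\<phi> \<in> car (dual V)"
  show "0 \<le> nrm (dual V) \<phi>" by (rule bound(1)[OF \<phi>])
  show "nrm (dual V) \<phi> = 0 \<longleftrightarrow> \<phi> = 0"
  proof
    assume 0: "nrm (dual V) \<phi> = 0"
    have "\<phi> x = 0" for x
      using bound(2)[OF \<phi>, of x] \<phi> 0 by (cases "x \<in> car V") (auto simp: car_dual_iff)
    then show "\<phi> = 0" by (simp add: fun_eq_iff)
  next
    assume "\<phi> = 0"
    then show "nrm (dual V) \<phi> = 0" using nrm_dual_le[of 0 V \<phi>] bound(1)[OF \<phi>] by simp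
  qed
  have le: "nrm (dual V) (c *\<^sub>R \<phi>) \<le> \<bar>c\<bar> * nrm (dual V) \<phi>" if \<phi>: "\<phi> \<in> car (dual V)" for c \<phi>
    using bound[OF \<phi>] by (intro nrm_dual_le) (auto simp: abs_mult mult.assoc intro: mult_left_mono)
  show "nrm (dual V) (c *\<^sub>R \<phi>) = \<bar>c\<bar> * nrm (dual V) \<phi>" for c
  proof (cases "c = 0")
    case True
    then show ?thesis using le[OF \<phi>, of 0] bound(1)[of "0 *\<^sub>R \<phi>"] subspace_scale[OF S \<phi>, of 0] by simp
  next
    case False
    have "nrm (dual V) ((1 / c) *\<^sub>R (c *\<^sub>R \<phi>)) \<le> \<bar>1 / c\<bar> * nrm (dual V) (c *\<^sub>R \<phi>)"
      by (rule le[OF subspace_scale[OF S \<phi>]])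
    then show ?thesis using le[OF \<phi>, of c] False by (simp add: field_simps)
  qed
  fix \<psi> assume \<psi>: "\<psi> \<in> car (dual V)"
  show "nrm (dual V) (\<phi> + \<psi>) \<le> nrm (dual V) \<phi> + nrm (dual V) \<psi>"
  proof (rule nrm_dual_le)
    fix x assume "x \<in> car V"
    then show "\<bar>(\<phi> + \<psi>) x\<bar> \<le> (nrm (dual V) \<phi> + nrm (dual V) \<psi>) * nrm V x"
      using bound(2)[OF \<phi>] bound(2)[OF \<psi>] by (fastforce simp: distrib_right)
  qed (use bound(1)[OF \<phi>] bound(1)[OF \<psi>] in simp)
qed

text \<open>
  A norming functional is defined on the whole ambient space; restricting it to the carrier and
  extending by zero gives the representative that belongs to \<open>dual V\<close>.
\<close>

lemma dual_separates:
  assumes V: "normed_space V" and v: "v \<in> car V"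
    and 0: "\<And>\<phi>. \<phi> \<in> car (dual V) \<Longrightarrow> \<phi> v = 0"
  shows "v = 0"
proof -
  obtain \<phi> where \<phi>: "linear \<phi>" "\<And>x. x \<in> car V \<Longrightarrow> \<bar>\<phi> x\<bar> \<le> nrm V x" "\<phi> v = nrm V v"
    using hahn_banach_norming[OF V v] by blast
  have "(\<lambda>x. if x \<in> car V then \<phi> x else 0) \<in> car (dual V)"
    unfolding car_dual_iff using normed_space_D(1)[OF V] \<phi>(2)
    by (auto simp: linear_add[OF \<phi>(1)] linear_scale[OF \<phi>(1)] subspace_add subspace_scale
        intro!: exI[of _ 1])
  from 0[OF this] show ?thesis using v \<phi>(3) normed_space_D(3)[OF V v] by simp
qed

section \<open>The Lipschitz-free space as a space of functionals\<close>

lemma lip_dual_bound: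
  assumes "f \<in> car (lip_dual X z)"
  shows "0 \<le> nrm (lip_dual X z) f"
    and "x \<in> mspace X \<Longrightarrow> y \<in> mspace X \<Longrightarrow> \<bar>f x - f y\<bar> \<le> nrm (lip_dual X z) f * mdist X x y"
proof -
  have n: "nrm (lip_dual X z) f = lip_const X real_line f" by (simp add: lip_dual_def Lip0_def)
  have ex: "\<exists>C. \<forall>p\<in>mspace X \<times> mspace X.
      (\<lambda>(x, y). nrm real_line (f x - f y)) p \<le> C * (\<lambda>(x, y). mdist X x y) p"
    using assms by (auto simp: lip_dual_iff real_line_def)
  show "0 \<le> nrm (lip_dual X z) f"
    unfolding n lip_const_conv by (rule best_constant(1)[OF ex]) auto
  show "\<bar>f x - f y\<bar> \<le> nrm (lip_dual X z) f * mdist X x y" if "x \<in> mspace X" "y \<in> mspace X"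
    using best_constant(2)[OF ex, of "(x, y)"] that
    unfolding n lip_const_conv by (auto simp: real_line_def)
qed

lemma nrm_lip_dual_le:
  assumes "0 \<le> K" "\<And>x y. x \<in> mspace X \<Longrightarrow> y \<in> mspace X \<Longrightarrow> \<bar>f x - f y\<bar> \<le> K * mdist X x y"
  shows "nrm (lip_dual X z) f \<le> K"
  unfolding lip_dual_def Lip0_def nspace.simps lip_const_conv
  by (rule best_constant_le) (use assms in \<open>auto simp: real_line_def\<close>)

lemma lip_dual_add:
  assumes f: "f \<in> car (lip_dual X z)" and g: "g \<in> car (lip_dual X z)"
  shows "f + g \<in> car (lip_dual X z)"
proof -
  have "\<bar>(f + g) x - (f + g) y\<bar> \<le> (nrm (lip_dual X z) f + nrm (lip_dual X z) g) * mdist X x y"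
    if "x \<in> mspace X" "y \<in> mspace X" for x y
    using lip_dual_bound(2)[OF f that] lip_dual_bound(2)[OF g that] by (simp add: distrib_right)
  then have "\<exists>C. \<forall>x\<in>mspace X. \<forall>y\<in>mspace X. \<bar>(f + g) x - (f + g) y\<bar> \<le> C * mdist X x y" by blast
  then show ?thesis using f g unfolding lip_dual_iff by simp
qed

lemma lip_dual_scale:
  assumes f: "f \<in> car (lip_dual X z)"
  shows "c *\<^sub>R f \<in> car (lip_dual X z)"
proof -
  have "\<bar>(c *\<^sub>R f) x - (c *\<^sub>R f) y\<bar> \<le> (\<bar>c\<bar> * nrm (lip_dual X z) f) * mdist X x y"
    if "x \<in> mspace X" "y \<in> mspace X" for x y
    using mult_left_mono[OF lip_dual_bound(2)[OF f that], of "\<bar>c\<bar>"]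
    by (simp add: abs_mult[symmetric] mult.assoc right_diff_distrib)
  then have "\<exists>C. \<forall>x\<in>mspace X. \<forall>y\<in>mspace X. \<bar>(c *\<^sub>R f) x - (c *\<^sub>R f) y\<bar> \<le> C * mdist X x y" by blast
  then show ?thesis using f unfolding lip_dual_iff by simp
qed

lemma sum_fun_apply: "(\<Sum>i\<in>A. h i) x = (\<Sum>i\<in>A. h i x)" for h :: "'i \<Rightarrow> 'a \<Rightarrow> 'b::comm_monoid_add"
  by (induction A rule: infinite_finite_induct) simp_all

text \<open>
  The algebraic properties hold for the generators and pass to their span. For the bound, each
  representation of \<open>m\<close> by the generators gives \<open>\<bar>m f\<bar> \<le> Lip(f) r\<close>, with \<open>r\<close> the cost of the
  representation, and the norm of \<open>m\<close> is the infimum of the costs.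
\<close>

lemma molecule_functional:
  assumes "m \<in> car (molecules X z)"
  shows "f \<notin> car (lip_dual X z) \<Longrightarrow> m f = 0"
    and "f \<in> car (lip_dual X z) \<Longrightarrow> g \<in> car (lip_dual X z) \<Longrightarrow> m (f + g) = m f + m g"
    and "f \<in> car (lip_dual X z) \<Longrightarrow> m (c *\<^sub>R f) = c * m f"
    and "f \<in> car (lip_dual X z) \<Longrightarrow> \<bar>m f\<bar> \<le> nrm (lip_dual X z) f * nrm (molecules X z) m"
proof -
  have span: "m \<in> span {delta X z x y | x y. x \<in> mspace X \<and> y \<in> mspace X}"
    using assms by (simp add: molecules_def)
  show "m f = 0" if "f \<notin> car (lip_dual X z)"
    by (rule span_induct[OF span, of "\<lambda>m. m f = 0"])
      (use that in \<open>auto simp: delta_def subspace_def\<close>)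
  show "m (f + g) = m f + m g" if "f \<in> car (lip_dual X z)" "g \<in> car (lip_dual X z)"
    by (rule span_induct[OF span, of "\<lambda>m. m (f + g) = m f + m g"])
      (use that lip_dual_add[OF that] in \<open>auto simp: delta_def subspace_def algebra_simps\<close>)
  show "m (c *\<^sub>R f) = c * m f" if "f \<in> car (lip_dual X z)"
    by (rule span_induct[OF span, of "\<lambda>m. m (c *\<^sub>R f) = c * m f"])
      (use that lip_dual_scale[OF that] in \<open>auto simp: delta_def subspace_def algebra_simps\<close>)
  assume f: "f \<in> car (lip_dual X z)"
  let ?L = "nrm (lip_dual X z) f"
  have rep: "\<bar>m f\<bar> \<le> ?L * r" if "rep X z m r" for r
  proof -
    obtain n c x y where r: "r = (\<Sum>i<(n::nat). \<bar>c i\<bar> * mdist X (x i) (y i))"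
      "\<forall>i<n. x i \<in> mspace X \<and> y i \<in> mspace X" "m = (\<Sum>i<n. c i *\<^sub>R delta X z (x i) (y i))"
      using \<open>rep X z m r\<close> unfolding rep_def by blast
    have "m f = (\<Sum>i<n. c i * (f (x i) - f (y i)))"
      unfolding r(3) sum_fun_apply using f by (simp add: delta_def)
    also have "\<bar>\<dots>\<bar> \<le> (\<Sum>i<n. ?L * (\<bar>c i\<bar> * mdist X (x i) (y i)))"
    proof (rule order_trans[OF sum_abs sum_mono])
      fix i assume "i \<in> {..<n}"
      then have "\<bar>f (x i) - f (y i)\<bar> \<le> ?L * mdist X (x i) (y i)"
        using r(2) lip_dual_bound(2)[OF f] by auto
      from mult_left_mono[OF this, of "\<bar>c i\<bar>"]
      show "\<bar>c i * (f (x i) - f (y i))\<bar> \<le> ?L * (\<bar>c i\<bar> * mdist X (x i) (y i))"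
        by (simp add: abs_mult mult_ac)
    qed
    finally show ?thesis by (simp add: r sum_distrib_left)
  qed
  show "\<bar>m f\<bar> \<le> ?L * nrm (molecules X z) m"
  proof (cases "?L = 0")
    case True
    then show ?thesis using assms rep by (auto simp: car_molecules)
  next
    case False
    then have L: "0 < ?L" using lip_dual_bound(1)[OF f] by simp
    have "\<bar>m f\<bar> / ?L \<le> nrm (molecules X z) m"
      by (rule nrm_ge[OF assms]) (use rep L in \<open>simp add: pos_divide_le_eq mult.commute\<close>)
    then show ?thesis using L by (simp add: pos_divide_le_eq mult.commute)
  qed
qed

text \<open>
  The properties survive the pointwise limits that define the completion, along which the norms
  converge as well.
\<close>

lemma lip_free_functional:
  assumes z: "z \<in> mspace X" and m: "m \<in> car (lip_free X z)"
  shows "f \<notin> car (lip_dual X z) \<Longrightarrow> m f = 0"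
    and "f \<in> car (lip_dual X z) \<Longrightarrow> g \<in> car (lip_dual X z) \<Longrightarrow> m (f + g) = m f + m g"
    and "f \<in> car (lip_dual X z) \<Longrightarrow> m (c *\<^sub>R f) = c * m f"
    and "f \<in> car (lip_dual X z) \<Longrightarrow> \<bar>m f\<bar> \<le> nrm (lip_dual X z) f * nrm (lip_free X z) m"
proof -
  interpret evaluation_space "molecules X z"
    by unfold_locales (use normed_molecules molecule_bound molecules_norming[OF z] in auto)
  have C: "C = lip_free X z" by (simp add: C_def lip_free_def)
  obtain s where s: "cauchy_limit (molecules X z) s m" using m car_C by (auto simp: C)
  note t = cl_tends[OF s] and M = molecule_functional[OF cl_car[OF s]]
  show "m f = 0" if "f \<notin> car (lip_dual X z)"
    by (rule LIMSEQ_unique[OF t]) (simp add: M(1)[OF that])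
  show "m (f + g) = m f + m g" if "f \<in> car (lip_dual X z)" "g \<in> car (lip_dual X z)"
    by (rule LIMSEQ_unique[OF t]) (simp add: M(2)[OF that] tendsto_add t)
  show "m (c *\<^sub>R f) = c * m f" if "f \<in> car (lip_dual X z)"
    by (rule LIMSEQ_unique[OF t]) (simp add: M(3)[OF that] tendsto_mult_left t)
  show "\<bar>m f\<bar> \<le> nrm (lip_dual X z) f * nrm (lip_free X z) m" if "f \<in> car (lip_dual X z)"
    by (rule LIMSEQ_le[OF tendsto_rabs[OF t] tendsto_mult_left[OF nrm_C[OF s, unfolded C]]])
      (use M(4)[OF that] in blast)
qed

lemma banach_lip_free: "z \<in> mspace X \<Longrightarrow> banach_space (lip_free X z)"
  by (drule lip_free_completion) (simp add: is_completion_def)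

lemma normed_lip_free: "z \<in> mspace X \<Longrightarrow> normed_space (lip_free X z)"
  by (drule banach_lip_free) (simp add: banach_space_def)

text \<open>
  The one-term representation bounds the norm above by \<open>d(x, y)\<close>. The distance to \<open>y\<close>, shifted to
  vanish at the base point, is 1-Lipschitz and shows that this bound is attained.
\<close>

lemma delta_lip_free:
  assumes z: "z \<in> mspace X" and x: "x \<in> mspace X" and y: "y \<in> mspace X"
  shows "delta X z x y \<in> car (lip_free X z)" "nrm (lip_free X z) (delta X z x y) = mdist X x y"
proof -
  have mol: "delta X z x y \<in> car (molecules X z)"
    unfolding car_molecules using rep_delta[OF x y] by blast
  have F: "delta X z x y \<in> car (lip_free X z)"
    "nrm (lip_free X z) (delta X z x y) = nrm (molecules X z) (delta X z x y)"
    using lip_free_completion[OF z] mol by (auto simp: is_completion_def)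
  show "delta X z x y \<in> car (lip_free X z)" by (rule F)
  define g where "g u = (if u \<in> mspace X then mdist X u y - mdist X z y else 0)" for u
  have g1: "\<bar>g u - g v\<bar> \<le> 1 * mdist X u v" if "u \<in> mspace X" "v \<in> mspace X" for u v
    using that y mdist_triangle[of u X v y] mdist_triangle[of v X u y] mdist_commute[of X u v]
    by (simp add: g_def)
  have g: "g \<in> car (lip_dual X z)"
    unfolding lip_dual_iff using z g1 by (auto simp: g_def simp del: mult_1 intro!: exI[of _ 1])
  have "mdist X x y = \<bar>delta X z x y g\<bar>" using g x y 
    by (simp add: delta_def) (simp add: g_def Metric_space.mdist_zero[OF Metric_space_mspace_mdist])
  also have "\<dots> \<le> nrm (lip_dual X z) g * nrm (molecules X z) (delta X z x y)"
    by (rule molecule_functional(4)[OF mol g])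
  also have "\<dots> \<le> 1 * nrm (molecules X z) (delta X z x y)"
    using nrm_lip_dual_le[of 1 X g z] g1 normed_space_D(2)[OF normed_molecules mol]
    by (intro mult_right_mono) auto
  finally show "nrm (lip_free X z) (delta X z x y) = mdist X x y"
    using F(2) nrm_le[OF rep_delta[OF x y, of z]] by simp
qed

text \<open>
  This is the easy half of \<open>F(X)\<^sup>* = X\<^sup>#\<close>, and the half that dualizability needs.
\<close>

lemma evaluation_in_dual:
  assumes z: "z \<in> mspace X" and f: "f \<in> car (lip_dual X z)"
  defines "\<epsilon> \<equiv> \<lambda>m. if m \<in> car (lip_free X z) then m f else 0"
  shows "\<epsilon> \<in> car (dual (lip_free X z))" "nrm (dual (lip_free X z)) \<epsilon> \<le> nrm (lip_dual X z) f"
proof -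
  note S = normed_space_D(1)[OF normed_lip_free[OF z]]
  show "\<epsilon> \<in> car (dual (lip_free X z))"
    unfolding car_dual_iff \<epsilon>_def using lip_free_functional(4)[OF z _ f] S
    by (auto simp: subspace_add subspace_scale)
  show "nrm (dual (lip_free X z)) \<epsilon> \<le> nrm (lip_dual X z) f"
    by (rule nrm_dual_le) (auto simp: \<epsilon>_def lip_free_functional(4)[OF z _ f] lip_dual_bound(1)[OF f])
qed

section \<open>Lipschitz maps into the dual\<close>

lemma car_Lip0_dual:
  assumes "normed_space E"
  shows "f \<in> car (Lip0 X z (dual E)) \<longleftrightarrow>
     (\<forall>x\<in>mspace X. f x \<in> car (dual E)) \<and>
     (\<exists>C. \<forall>x\<in>mspace X. \<forall>y\<in>mspace X. nrm (dual E) (f x - f y) \<le> C * mdist X x y) \<and>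
     f z = 0 \<and> (\<forall>x. x \<notin> mspace X \<longrightarrow> f x = 0)"
proof -
  note D = normed_space_dual[OF assms]
  show ?thesis
  proof (cases "\<forall>x\<in>mspace X. f x \<in> car (dual E)")
    case True
    then have "(\<forall>x\<in>mspace X. \<forall>y\<in>mspace X. ndist (dual E) (f x) (f y) \<le> C * mdist X x y) \<longleftrightarrow>
        (\<forall>x\<in>mspace X. \<forall>y\<in>mspace X. nrm (dual E) (f x - f y) \<le> C * mdist X x y)" for C
      by (simp add: ndist_def)
    with True show ?thesis
      by (simp add: Lip0_def Lipschitz_continuous_map_def norm_metric[OF D] Pi_iff)
  next
    case False
    then show ?thesis
      by (auto simp: Lip0_def Lipschitz_continuous_map_def norm_metric[OF D] Pi_iff)
  qed
qed

lemma slice_in_lip_dual: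
  assumes E: "normed_space E" and f: "f \<in> car (Lip0 X z (dual E))" and e: "e \<in> car E"
  shows "(\<lambda>x. f x e) \<in> car (lip_dual X z)"
proof -
  obtain C where C: "\<And>x y. x \<in> mspace X \<Longrightarrow> y \<in> mspace X \<Longrightarrow> nrm (dual E) (f x - f y) \<le> C * mdist X x y"
    using f by (auto simp: car_Lip0_dual[OF E])
  have "\<bar>f x e - f y e\<bar> \<le> (C * nrm E e) * mdist X x y" if "x \<in> mspace X" "y \<in> mspace X" for x y
  proof -
    have "f x - f y \<in> car (dual E)"
      using f that subspace_diff[OF subspace_dual[OF E]] by (simp add: car_Lip0_dual[OF E])
    from nrm_dual_bound(2)[OF E this e]
    show ?thesis
      using mult_right_mono[OF C[OF that] normed_space_D(2)[OF E e]] by (simp add: mult_ac)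
  qed
  then have "\<exists>C. \<forall>x\<in>mspace X. \<forall>y\<in>mspace X. \<bar>f x e - f y e\<bar> \<le> C * mdist X x y" by blast
  then show ?thesis using f by (simp add: lip_dual_iff car_Lip0_dual[OF E])
qed

lemma rank_one_in_Lip0:
  assumes E: "normed_space E" and g: "g \<in> car (lip_dual X z)" and \<phi>: "\<phi> \<in> car (dual E)"
  shows "(\<lambda>x. g x *\<^sub>R \<phi>) \<in> car (Lip0 X z (dual E))"
proof -
  have "nrm (dual E) (g x *\<^sub>R \<phi> - g y *\<^sub>R \<phi>)
      \<le> (nrm (lip_dual X z) g * nrm (dual E) \<phi>) * mdist X x y"
    if "x \<in> mspace X" "y \<in> mspace X" for x y
  proof -
    have "nrm (dual E) (g x *\<^sub>R \<phi> - g y *\<^sub>R \<phi>) = \<bar>g x - g y\<bar> * nrm (dual E) \<phi>"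
      using normed_space_D(4)[OF normed_space_dual[OF E] \<phi>, of "g x - g y"]
      by (simp add: scaleR_left_diff_distrib)
    then show ?thesis
      using mult_right_mono[OF lip_dual_bound(2)[OF g that] nrm_dual_bound(1)[OF E \<phi>]]
      by (simp add: mult_ac)
  qed
  then have "\<exists>C. \<forall>x\<in>mspace X. \<forall>y\<in>mspace X.
      nrm (dual E) (g x *\<^sub>R \<phi> - g y *\<^sub>R \<phi>) \<le> C * mdist X x y" by blast
  then show ?thesis
    using g subspace_scale[OF subspace_dual[OF E] \<phi>] by (simp add: car_Lip0_dual[OF E] lip_dual_iff)
qed

section \<open>Comparison of the two tensor products\<close>

text \<open>
  The bilinear form \<open>B\<^sub>f\<close>; it is cut off to zero because \<open>bilinear_forms\<close> contains only extensions
  by zero.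
\<close>

definition slice_form :: "'x metric \<Rightarrow> 'x \<Rightarrow> 'e::real_vector nspace \<Rightarrow> ('x \<Rightarrow> 'e \<Rightarrow> real) \<Rightarrow>
    (('x \<Rightarrow> real) \<Rightarrow> real) \<Rightarrow> 'e \<Rightarrow> real" where
  "slice_form X z E f = (\<lambda>m e. if m \<in> car (lip_free X z) \<and> e \<in> car E then m (\<lambda>x. f x e) else 0)"

text \<open>
  The map \<open>\<Psi>\<close>. It is defined on all functionals of bilinear forms, not only on tensors, so that it is
  linear on a whole type.
\<close>

definition to_lip_functional :: "'x metric \<Rightarrow> 'x \<Rightarrow> 'e::real_vector nspace \<Rightarrow>
    (((('x \<Rightarrow> real) \<Rightarrow> real) \<Rightarrow> 'e \<Rightarrow> real) \<Rightarrow> real) \<Rightarrow> ('x \<Rightarrow> 'e \<Rightarrow> real) \<Rightarrow> real" where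
  "to_lip_functional X z E u =
     (\<lambda>f. if f \<in> car (Lip0 X z (dual E)) then u (slice_form X z E f) else 0)"

lemma slice_form_bilinear:
  assumes z: "z \<in> mspace X" and E: "normed_space E" and f: "f \<in> car (Lip0 X z (dual E))"
  shows "slice_form X z E f \<in> bilinear_forms (lip_free X z) E"
proof -
  note SF = normed_space_D(1)[OF normed_lip_free[OF z]] and SE = normed_space_D(1)[OF E]
  note slice = slice_in_lip_dual[OF E f] and LF = lip_free_functional[OF z]
  have fx: "f x (d + e) = f x d + f x e" "f x (c *\<^sub>R d) = c * f x d"
    if "d \<in> car E" "e \<in> car E" for x c d e
  proof -
    have "f x \<in> car (dual E)"
      using f subspace_0[OF subspace_dual[OF E]] by (cases "x \<in> mspace X") (auto simp: car_Lip0_dual[OF E])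
    then show "f x (d + e) = f x d + f x e" "f x (c *\<^sub>R d) = c * f x d"
      using that by (simp_all add: car_dual_iff)
  qed
  have add: "m (\<lambda>x. f x (d + e)) = m (\<lambda>x. f x d) + m (\<lambda>x. f x e)"
    if "m \<in> car (lip_free X z)" "d \<in> car E" "e \<in> car E" for m d e
    using LF(2)[OF that(1) slice[OF that(2)] slice[OF that(3)]] fx that by (simp add: plus_fun_def)
  have scale: "m (\<lambda>x. f x (c *\<^sub>R d)) = c * m (\<lambda>x. f x d)"
    if "m \<in> car (lip_free X z)" "d \<in> car E" for m c d
    using LF(3)[OF that(1) slice[OF that(2)], of c] fx that by (simp add: scaleR_fun_def)
  show ?thesis
    by (auto simp: bilinear_forms_def linear_op_def real_line_def slice_form_def add scale
        subspace_add[OF SF] subspace_scale[OF SF] subspace_add[OF SE] subspace_scale[OF SE])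
qed

lemma linear_to_lip_functional: "linear (to_lip_functional X z E)"
  by (rule linearI) (auto simp: to_lip_functional_def fun_eq_iff)

lemma to_lip_functional_tensor:
  assumes z: "z \<in> mspace X" and E: "normed_space E"
    and m: "m \<in> car (lip_free X z)" and e: "e \<in> car E"
  shows "to_lip_functional X z E (tensor (lip_free X z) E m e) =
    (\<lambda>f. if f \<in> car (Lip0 X z (dual E)) then m (\<lambda>x. f x e) else 0)"
  using slice_form_bilinear[OF z E] m e
  by (auto simp: to_lip_functional_def tensor_def fun_eq_iff) (simp_all add: slice_form_def)

lemma to_lip_functional_delta:
  assumes z: "z \<in> mspace X" and E: "normed_space E"
    and x: "x \<in> mspace X" and y: "y \<in> mspace X" and e: "e \<in> car E"
  shows "to_lip_functional X z E (tensor (lip_free X z) E (delta X z x y) e) = lip_tensor X z E x y e"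
  using to_lip_functional_tensor[OF z E delta_lip_free(1)[OF z x y] e]
  by (auto simp: lip_tensor_def delta_def[of X z x y] slice_in_lip_dual[OF E _ e] fun_eq_iff)

text \<open>
  Scalars are absorbed into the first factor. The tensors occurring in a linear combination serve as
  their own indices.
\<close>

lemma tensor_product_finite_sum:
  fixes F :: "'a::real_vector nspace" and G :: "'b::real_vector nspace"
  assumes F: "normed_space F" and G: "normed_space G" and u: "u \<in> tensor_product F G"
  obtains I :: "(('a \<Rightarrow> 'b \<Rightarrow> real) \<Rightarrow> real) set" and x y
  where "finite I" "\<forall>i\<in>I. x i \<in> car F" "\<forall>i\<in>I. y i \<in> car G"
    "u = (\<Sum>i\<in>I. tensor F G (x i) (y i))"
proof -
  obtain I r where I: "finite I" "I \<subseteq> {tensor F G x y | x y. x \<in> car F \<and> y \<in> car G}"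
    "u = (\<Sum>a\<in>I. r a *\<^sub>R a)"
    using u unfolding tensor_product_def span_explicit by blast
  have "\<forall>a\<in>I. \<exists>x y. x \<in> car F \<and> y \<in> car G \<and> a = tensor F G x y" using I(2) by blast
  then obtain x y where xy: "\<And>a. a \<in> I \<Longrightarrow> x a \<in> car F" "\<And>a. a \<in> I \<Longrightarrow> y a \<in> car G"
    "\<And>a. a \<in> I \<Longrightarrow> a = tensor F G (x a) (y a)" by metis
  have "r a *\<^sub>R a = tensor F G (r a *\<^sub>R x a) (y a)" if a: "a \<in> I" for a
  proof -
    have "r a *\<^sub>R tensor F G (x a) (y a) = tensor F G (r a *\<^sub>R x a) (y a)"
      using xy(1,2)[OF a] by (auto simp: tensor_def fun_eq_iff bilinear_forms_def linear_op_def)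
    then show ?thesis using xy(3)[OF a] by simp
  qed
  then have "u = (\<Sum>a\<in>I. tensor F G (r a *\<^sub>R x a) (y a))" unfolding I(3) by (rule sum.cong[OF refl])
  then show thesis
    using xy(1,2) subspace_scale[OF normed_space_D(1)[OF F]] I(1)
    by (intro that[of I "\<lambda>a. r a *\<^sub>R x a" y]) auto
qed

lemma linear_op_sum:
  assumes V: "subspace (car V)" and T: "linear_op V W T" and "finite I" "\<And>i. i \<in> I \<Longrightarrow> x i \<in> car V"
  shows "T (\<Sum>i\<in>I. c i *\<^sub>R x i) = (\<Sum>i\<in>I. c i *\<^sub>R T (x i))"
  using assms(3,4)
proof (induction I rule: finite_induct)
  case empty
  show ?case using T subspace_0[OF V] unfolding linear_op_def by (metis scaleR_zero_left sum.empty)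
next
  case (insert i I)
  have "(\<Sum>i\<in>I. c i *\<^sub>R x i) \<in> car V" "c i *\<^sub>R x i \<in> car V"
    using insert.prems by (auto intro!: subspace_sum[OF V] subspace_scale[OF V])
  then show ?case using insert T by (simp add: linear_op_def)
qed

text \<open>
  The hypothesis is a family of relations in \<open>G\<close>, one for each point \<open>j\<close> at which the functions
  \<open>x i\<close> are evaluated. Its coordinates in a basis \<open>b\<close> of the span of the \<open>y i\<close> are relations
  between the functions \<open>x i\<close> themselves, one for each \<open>v \<in> b\<close>. After expanding the second argument
  of \<open>B\<close> in \<open>b\<close>, linearity in the first argument makes each coefficient vanish. The argument is
  purely algebraic and so covers unbounded forms.
\<close>

lemma bilinear_sum_zero:
  fixes x :: "'i \<Rightarrow> 'j \<Rightarrow> real"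
  assumes F: "subspace (car F)" and G: "subspace (car G)" and B: "B \<in> bilinear_forms F G"
    and I: "finite I" and x: "\<And>i. i \<in> I \<Longrightarrow> x i \<in> car F" and y: "\<And>i. i \<in> I \<Longrightarrow> y i \<in> car G"
    and 0: "\<And>j. (\<Sum>i\<in>I. x i j *\<^sub>R y i) = 0"
  shows "(\<Sum>i\<in>I. B (x i) (y i)) = 0"
proof -
  obtain b where b: "b \<subseteq> y ` I" "independent b" "y ` I \<subseteq> span b"
    using maximal_independent_subset by blast
  have fin: "finite b" and bG: "b \<subseteq> car G" using b(1) I y by (auto intro: finite_subset)
  have yi: "y i = (\<Sum>v\<in>b. representation b (y i) v *\<^sub>R v)" if "i \<in> I" for i
    using sum_representation_eq[OF b(2) _ fin] b(3) that by auto
  have zero: "(\<Sum>i\<in>I. representation b (y i) v *\<^sub>R x i) = 0" for v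
  proof
    fix j
    have "(\<Sum>i\<in>I. x i j * representation b (y i) v) = representation b (\<Sum>i\<in>I. x i j *\<^sub>R y i) v"
      using b(2,3) by (subst representation_sum) (auto simp: span_scale representation_scale intro!: sum.cong)
    then show "(\<Sum>i\<in>I. representation b (y i) v *\<^sub>R x i) j = 0 j"
      by (simp add: sum_fun_apply 0 representation_zero mult.commute)
  qed
  have "(\<Sum>i\<in>I. B (x i) (y i)) = (\<Sum>i\<in>I. \<Sum>v\<in>b. representation b (y i) v * B (x i) v)"
  proof (rule sum.cong[OF refl])
    fix i assume i: "i \<in> I"
    have "linear_op G real_line (B (x i))" using B x[OF i] by (auto simp: bilinear_forms_def)
    from linear_op_sum[OF G this fin, where x = "\<lambda>v. v" and c = "representation b (y i)"]
    show "B (x i) (y i) = (\<Sum>v\<in>b. representation b (y i) v * B (x i) v)"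
      using bG yi[OF i] by auto
  qed
  also have "\<dots> = (\<Sum>v\<in>b. \<Sum>i\<in>I. representation b (y i) v * B (x i) v)" by (rule sum.swap)
  also have "\<dots> = (\<Sum>v\<in>b. 0)"
  proof (rule sum.cong[OF refl])
    fix v assume v: "v \<in> b"
    have lin: "linear_op F real_line (\<lambda>x. B x v)" using B v bG by (auto simp: bilinear_forms_def)
    have "(\<Sum>i\<in>I. representation b (y i) v * B (x i) v)
        = B (\<Sum>i\<in>I. representation b (y i) v *\<^sub>R x i) v"
      using linear_op_sum[OF F lin I x, where c = "\<lambda>i. representation b (y i) v"] by simp
    also have "\<dots> = B (0 *\<^sub>R 0) v" by (simp add: zero)
    also have "\<dots> = 0" using lin subspace_0[OF F] unfolding linear_op_def by (metis scaleR_zero_left)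
    finally show "(\<Sum>i\<in>I. representation b (y i) v * B (x i) v) = 0" .
  qed
  finally show ?thesis by simp
qed

text \<open>
  Rank-one maps \<open>x \<mapsto> g x \<phi>\<close> already detect a nonzero tensor: letting \<open>\<phi>\<close> vary with \<open>g\<close> fixed
  gives a relation in \<open>E\<close> for every \<open>g\<close>, to which \<open>bilinear_sum_zero\<close> applies. Off \<open>X\<^sup>#\<close> these
  relations are trivial, because elements of \<open>F(X)\<close> vanish there.
\<close>

lemma inj_on_to_lip_functional:
  fixes X :: "'x metric" and E :: "'e::real_vector nspace"
  assumes z: "z \<in> mspace X" and E: "normed_space E"
  shows "inj_on (to_lip_functional X z E) (tensor_product (lip_free X z) E)"
proof -
  let ?F = "lip_free X z" and ?\<Psi> = "to_lip_functional X z E"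
  note F = normed_lip_free[OF z]
  have "u = 0" if u: "u \<in> tensor_product ?F E" and 0: "?\<Psi> u = 0" for u
  proof -
    obtain I :: "(((('x \<Rightarrow> real) \<Rightarrow> real) \<Rightarrow> 'e \<Rightarrow> real) \<Rightarrow> real) set" and m e
      where I: "finite I" and me: "\<forall>i\<in>I. m i \<in> car ?F" "\<forall>i\<in>I. e i \<in> car E"
      and u': "u = (\<Sum>i\<in>I. tensor ?F E (m i) (e i))"
      by (rule tensor_product_finite_sum[OF F E u]) (rule that, assumption+)
    note m = bspec[OF me(1)] and e = bspec[OF me(2)]
    have \<Psi>: "(\<Sum>i\<in>I. m i (\<lambda>x. f x (e i))) = 0" if f: "f \<in> car (Lip0 X z (dual E))" for f
    proof -
      have "?\<Psi> u f = (\<Sum>i\<in>I. ?\<Psi> (tensor ?F E (m i) (e i)) f)"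
        unfolding u' linear_sum[OF linear_to_lip_functional] sum_fun_apply ..
      also have "\<dots> = (\<Sum>i\<in>I. m i (\<lambda>x. f x (e i)))"
        by (rule sum.cong) (use m e f in \<open>simp_all add: to_lip_functional_tensor[OF z E]\<close>)
      finally show ?thesis using 0 by simp
    qed
    have zero: "(\<Sum>i\<in>I. m i g *\<^sub>R e i) = 0" for g
    proof (cases "g \<in> car (lip_dual X z)")
      case True
      show ?thesis
      proof (rule dual_separates[OF E])
        show "(\<Sum>i\<in>I. m i g *\<^sub>R e i) \<in> car E"
          using e normed_space_D(1)[OF E] by (intro subspace_sum subspace_scale)
        fix \<phi> assume \<phi>: "\<phi> \<in> car (dual E)"
        then have "linear_op E real_line \<phi>" by (simp add: dual_def bounded_op_def)
        then have "\<phi> (\<Sum>i\<in>I. m i g *\<^sub>R e i) = (\<Sum>i\<in>I. m i g *\<^sub>R \<phi> (e i))"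
          using e I normed_space_D(1)[OF E] by (intro linear_op_sum)
        also have "\<dots> = (\<Sum>i\<in>I. m i (\<lambda>x. (g x *\<^sub>R \<phi>) (e i)))"
        proof (rule sum.cong[OF refl])
          fix i assume "i \<in> I"
          then show "m i g *\<^sub>R \<phi> (e i) = m i (\<lambda>x. (g x *\<^sub>R \<phi>) (e i))"
            using lip_free_functional(3)[OF z m True, of i "\<phi> (e i)"]
            by (simp add: scaleR_fun_def mult.commute)
        qed
        also have "\<dots> = 0" by (rule \<Psi>[OF rank_one_in_Lip0[OF E True \<phi>]])
        finally show "\<phi> (\<Sum>i\<in>I. m i g *\<^sub>R e i) = 0" .
      qed
    next
      case False
      then show ?thesis using lip_free_functional(1)[OF z m] by simp
    qed
    have "(\<Sum>i\<in>I. B (m i) (e i)) = 0" if "B \<in> bilinear_forms ?F E" for B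
      by (rule bilinear_sum_zero[OF normed_space_D(1)[OF F] normed_space_D(1)[OF E] that I m e zero])
    then have "u B = 0" for B
      by (cases "B \<in> bilinear_forms ?F E") (simp_all add: u' sum_fun_apply tensor_def)
    then show "u = 0" by (simp add: fun_eq_iff)
  qed
  moreover have "subspace (tensor_product ?F E)" by (simp add: tensor_product_def)
  ultimately show ?thesis
    unfolding linear_injective_on_subspace_0[OF linear_to_lip_functional \<open>subspace _\<close>] by blast
qed

text \<open>
  The map \<open>\<Phi>\<close>, as a linear left inverse of \<open>\<Psi>\<close>. On the Lipschitz tensor product, which lies in the
  image of \<open>\<Psi>\<close>, it does not depend on the choice.
\<close>

definition to_tensor :: "'x metric \<Rightarrow> 'x \<Rightarrow> 'e::real_vector nspace \<Rightarrow>
    (('x \<Rightarrow> 'e \<Rightarrow> real) \<Rightarrow> real) \<Rightarrow> ((('x \<Rightarrow> real) \<Rightarrow> real) \<Rightarrow> 'e \<Rightarrow> real) \<Rightarrow> real" where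
  "to_tensor X z E = (SOME \<Phi>. linear \<Phi> \<and> range \<Phi> \<subseteq> tensor_product (lip_free X z) E \<and>
     (\<forall>u\<in>tensor_product (lip_free X z) E. \<Phi> (to_lip_functional X z E u) = u))"

lemma to_tensor:
  assumes z: "z \<in> mspace X" and E: "normed_space E"
  shows "linear (to_tensor X z E)"
    and "to_tensor X z E v \<in> tensor_product (lip_free X z) E"
    and "u \<in> tensor_product (lip_free X z) E \<Longrightarrow> to_tensor X z E (to_lip_functional X z E u) = u"
proof -
  have "subspace (tensor_product (lip_free X z) E)" by (simp add: tensor_product_def)
  from linear_exists_left_inverse_on[OF linear_to_lip_functional this inj_on_to_lip_functional[OF z E]]
  have "\<exists>\<Phi>. linear \<Phi> \<and> range \<Phi> \<subseteq> tensor_product (lip_free X z) E \<and>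
     (\<forall>u\<in>tensor_product (lip_free X z) E. \<Phi> (to_lip_functional X z E u) = u)" by blast
  from someI_ex[OF this, folded to_tensor_def]
  show "linear (to_tensor X z E)" "to_tensor X z E v \<in> tensor_product (lip_free X z) E"
    "u \<in> tensor_product (lip_free X z) E \<Longrightarrow> to_tensor X z E (to_lip_functional X z E u) = u"
    by auto
qed

lemma tensor_in_tensor_product: "x \<in> car F \<Longrightarrow> y \<in> car G \<Longrightarrow> tensor F G x y \<in> tensor_product F G"
  unfolding tensor_product_def by (rule span_base) blast

lemma to_tensor_lip_tensor:
  assumes z: "z \<in> mspace X" and E: "normed_space E"
    and x: "x \<in> mspace X" and y: "y \<in> mspace X" and e: "e \<in> car E"
  shows "to_tensor X z E (lip_tensor X z E x y e) = tensor (lip_free X z) E (delta X z x y) e"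
  using to_tensor(3)[OF z E tensor_in_tensor_product[OF delta_lip_free(1)[OF z x y] e]]
  by (simp add: to_lip_functional_delta[OF z E x y e])

lemma to_tensor_sum:
  assumes z: "z \<in> mspace X" and E: "normed_space E"
    and "\<forall>i<n. x i \<in> mspace X \<and> y i \<in> mspace X \<and> e i \<in> car E"
  shows "to_tensor X z E (\<Sum>i<(n::nat). lip_tensor X z E (x i) (y i) (e i)) =
    (\<Sum>i<n. tensor (lip_free X z) E (delta X z (x i) (y i)) (e i))"
  unfolding linear_sum[OF to_tensor(1)[OF z E]]
  by (rule sum.cong) (use assms(3) in \<open>simp_all add: to_tensor_lip_tensor[OF z E]\<close>)

text \<open>
  A left inverse of \<open>\<Psi>\<close> is injective on the image of \<open>\<Psi>\<close>, and the generators of the Lipschitz tensor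
  product are in that image. This is what makes the transported norm definite.
\<close>

lemma to_tensor_eq_0:
  assumes z: "z \<in> mspace X" and E: "normed_space E"
    and v: "v \<in> lip_tensor_product X z E" and 0: "to_tensor X z E v = 0"
  shows "v = 0"
proof -
  let ?F = "lip_free X z" and ?\<Psi> = "to_lip_functional X z E"
  have "{lip_tensor X z E x y e | x y e. x \<in> mspace X \<and> y \<in> mspace X \<and> e \<in> car E}
      \<subseteq> ?\<Psi> ` tensor_product ?F E"
    using to_lip_functional_delta[OF z E, symmetric]
      tensor_in_tensor_product[OF delta_lip_free(1)[OF z]] by blast
  moreover have "subspace (?\<Psi> ` tensor_product ?F E)"
    by (rule linear_subspace_image[OF linear_to_lip_functional]) (simp add: tensor_product_def)
  ultimately have "lip_tensor_product X z E \<subseteq> ?\<Psi> ` tensor_product ?F E"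
    unfolding lip_tensor_product_def by (rule span_minimal)
  then obtain u where "u \<in> tensor_product ?F E" "v = ?\<Psi> u" using v by blast
  then show ?thesis using 0 to_tensor(3)[OF z E] linear_0[OF linear_to_lip_functional] by metis
qed

section \<open>The Lipschitz cross-norm generated by a tensor norm\<close>

lemma tensor_functional_sum:
  assumes F: "normed_space F" and G: "normed_space G"
    and \<phi>: "\<phi> \<in> car (dual F)" and \<psi>: "\<psi> \<in> car (dual G)"
    and I: "\<And>i. i \<in> I \<Longrightarrow> x i \<in> car F \<and> y i \<in> car G"
  shows "tensor_functional \<phi> \<psi> (\<Sum>i\<in>I. tensor F G (x i) (y i)) = (\<Sum>i\<in>I. \<phi> (x i) * \<psi> (y i))"
proof -
  have "(\<lambda>x y. \<phi> x * \<psi> y) \<in> bilinear_forms F G"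
    using \<phi> \<psi> by (auto simp: bilinear_forms_def linear_op_def real_line_def car_dual_iff algebra_simps)
  then show ?thesis by (simp add: tensor_functional_def sum_fun_apply tensor_def)
qed

lemma lip_cross_norm_to_tensor:
  assumes z: "z \<in> mspace X" and E: "normed_space E"
    and \<nu>: "reasonable_cross_norm (lip_free X z) E \<nu>"
  shows "lip_cross_norm X z E (\<lambda>u. \<nu> (to_tensor X z E u))"
proof -
  let ?\<Phi> = "to_tensor X z E"
  note lin = to_tensor(1)[OF z E] and ran = to_tensor(2)[OF z E]
  have no: "norm_on (tensor_product (lip_free X z) E) \<nu>"
    and cross: "\<And>m e. m \<in> car (lip_free X z) \<Longrightarrow> e \<in> car E \<Longrightarrow>
      \<nu> (tensor (lip_free X z) E m e) = nrm (lip_free X z) m * nrm E e"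
    using \<nu> by (auto simp: reasonable_cross_norm_def)
  have "?\<Phi> v = 0 \<longleftrightarrow> v = 0" if "v \<in> lip_tensor_product X z E" for v
    using to_tensor_eq_0[OF z E that] linear_0[OF lin] by blast
  then have "norm_on (lip_tensor_product X z E) (\<lambda>u. \<nu> (?\<Phi> u))"
    using no ran by (simp add: norm_on_def linear_add[OF lin] linear_scale[OF lin])
  then show ?thesis
    by (simp add: lip_cross_norm_def to_tensor_lip_tensor[OF z E] cross delta_lip_free[OF z])
qed

text \<open>
  The sum in question is the value of the product functional of \<open>m \<mapsto> m(f)\<close> and \<open>\<phi>\<close> on the
  corresponding tensor, and a reasonable cross-norm dominates such values.
\<close>

lemma dualizable_to_tensor:
  assumes z: "z \<in> mspace X" and E: "normed_space E"
    and \<nu>: "reasonable_cross_norm (lip_free X z) E \<nu>"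
  shows "dualizable X z E (\<lambda>u. \<nu> (to_tensor X z E u))"
  unfolding dualizable_def
proof (intro ballI allI impI)
  fix f \<phi> and n :: nat and x y e
  assume f: "f \<in> car (lip_dual X z)" and \<phi>: "\<phi> \<in> car (dual E)"
    and xye: "\<forall>i<n. x i \<in> mspace X \<and> y i \<in> mspace X \<and> e i \<in> car E"
  let ?F = "lip_free X z"
  let ?u = "\<Sum>i<n. tensor ?F E (delta X z (x i) (y i)) (e i)"
  define \<epsilon> where "\<epsilon> m = (if m \<in> car ?F then m f else 0)" for m
  have \<epsilon>: "\<epsilon> \<in> car (dual ?F)" "nrm (dual ?F) \<epsilon> \<le> nrm (lip_dual X z) f"
    using evaluation_in_dual[OF z f] by (simp_all add: \<epsilon>_def[abs_def])
  have \<delta>: "delta X z (x i) (y i) \<in> car ?F" if "i < n" for i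
    using xye that by (intro delta_lip_free(1)[OF z]) auto
  have u: "?u \<in> tensor_product ?F E"
    unfolding to_tensor_sum[OF z E xye, symmetric] by (rule to_tensor(2)[OF z E])
  then have nu: "0 \<le> \<nu> ?u" using \<nu> by (simp add: reasonable_cross_norm_def norm_on_def)
  have "(\<Sum>i<n. (f (x i) - f (y i)) * \<phi> (e i)) = (\<Sum>i<n. \<epsilon> (delta X z (x i) (y i)) * \<phi> (e i))"
    using \<delta> f by (intro sum.cong refl) (simp add: \<epsilon>_def delta_def[of X z _ _])
  also have "\<dots> = tensor_functional \<epsilon> \<phi> ?u"
    using \<delta> xye by (intro tensor_functional_sum[symmetric] normed_lip_free z E \<epsilon> \<phi>) auto
  also have "\<bar>\<dots>\<bar> \<le> nrm (dual ?F) \<epsilon> * nrm (dual E) \<phi> * \<nu> ?u"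
    using \<nu> \<epsilon>(1) \<phi> u by (simp add: reasonable_cross_norm_def)
  also have "\<dots> \<le> nrm (lip_dual X z) f * nrm (dual E) \<phi> * \<nu> ?u"
    by (intro mult_right_mono \<epsilon> nrm_dual_bound(1)[OF E \<phi>] nu)
  finally show "\<bar>\<Sum>i<n. (f (x i) - f (y i)) * \<phi> (e i)\<bar> \<le> nrm (lip_dual X z) f * nrm (dual E) \<phi> *
      \<nu> (to_tensor X z E (\<Sum>i<n. lip_tensor X z E (x i) (y i) (e i)))"
    unfolding to_tensor_sum[OF z E xye] .
qed

theorem theorem3p1:
  fixes \<alpha> :: "(('x \<Rightarrow> real) \<Rightarrow> real, 'e::real_vector) tensor_norm_assignment"
  assumes "tensor_norm \<alpha>"
  shows "\<exists>\<alpha>L :: 'x metric \<Rightarrow> 'x \<Rightarrow> 'e nspace \<Rightarrow> (('x \<Rightarrow> 'e \<Rightarrow> real) \<Rightarrow> real) \<Rightarrow> real.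
    \<forall>X z E. z \<in> mspace X \<and> banach_space E \<longrightarrow>
      lip_cross_norm X z E (\<alpha>L X z E) \<and> dualizable X z E (\<alpha>L X z E) \<and>
      (\<forall>(n::nat) x y e. (\<forall>i<n. x i \<in> mspace X \<and> y i \<in> mspace X \<and> e i \<in> car E) \<longrightarrow>
         \<alpha>L X z E (\<Sum>i<n. lip_tensor X z E (x i) (y i) (e i)) =
         \<alpha> (lip_free X z) E (\<Sum>i<n. tensor (lip_free X z) E (delta X z (x i) (y i)) (e i))) \<and>
      (\<exists>\<Phi>. linear_isometry (lip_tensor_space (\<alpha>L X z E) X z E)
                            (tensor_space \<alpha> (lip_free X z) E) \<Phi> \<and>
         (\<forall>(n::nat) x y e. (\<forall>i<n. x i \<in> mspace X \<and> y i \<in> mspace X \<and> e i \<in> car E) \<longrightarrow>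
            \<Phi> (\<Sum>i<n. lip_tensor X z E (x i) (y i) (e i)) =
            (\<Sum>i<n. tensor (lip_free X z) E (delta X z (x i) (y i)) (e i))))"
proof (rule exI[of _ "\<lambda>X z E u. \<alpha> (lip_free X z) E (to_tensor X z E u)"], intro allI impI,
    elim conjE, intro conjI)
  fix X :: "'x metric" and z and E :: "'e nspace"
  assume z: "z \<in> mspace X" and "banach_space E"
  then have E: "normed_space E" and \<nu>: "reasonable_cross_norm (lip_free X z) E (\<alpha> (lip_free X z) E)"
    using assms banach_lip_free[OF z] by (auto simp: tensor_norm_def banach_space_def)
  let ?\<alpha>L = "\<lambda>u. \<alpha> (lip_free X z) E (to_tensor X z E u)"
  show "lip_cross_norm X z E ?\<alpha>L" by (rule lip_cross_norm_to_tensor[OF z E \<nu>])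
  show "dualizable X z E ?\<alpha>L" by (rule dualizable_to_tensor[OF z E \<nu>])
  note sums = to_tensor_sum[OF z E]
  show "\<forall>(n::nat) x y e. (\<forall>i<n. x i \<in> mspace X \<and> y i \<in> mspace X \<and> e i \<in> car E) \<longrightarrow>
      ?\<alpha>L (\<Sum>i<n. lip_tensor X z E (x i) (y i) (e i)) =
      \<alpha> (lip_free X z) E (\<Sum>i<n. tensor (lip_free X z) E (delta X z (x i) (y i)) (e i))"
    by (intro allI impI, rule arg_cong[where f = "\<alpha> (lip_free X z) E"], rule sums)
  have "linear_isometry (lip_tensor_space ?\<alpha>L X z E) (tensor_space \<alpha> (lip_free X z) E) (to_tensor X z E)"
    using to_tensor(2)[OF z E]
    by (simp add: linear_isometry_def linear_op_def lip_tensor_space_def tensor_space_def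
        linear_add[OF to_tensor(1)[OF z E]] linear_scale[OF to_tensor(1)[OF z E]])
  with sums show "\<exists>\<Phi>. linear_isometry (lip_tensor_space ?\<alpha>L X z E) (tensor_space \<alpha> (lip_free X z) E) \<Phi> \<and>
      (\<forall>(n::nat) x y e. (\<forall>i<n. x i \<in> mspace X \<and> y i \<in> mspace X \<and> e i \<in> car E) \<longrightarrow>
        \<Phi> (\<Sum>i<n. lip_tensor X z E (x i) (y i) (e i)) =
        (\<Sum>i<n. tensor (lip_free X z) E (delta X z (x i) (y i)) (e i)))"
    by (intro exI[of _ "to_tensor X z E"] conjI allI impI)
qed

end
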